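(* For any integer $N\geq 8$, the graph $\mathcal{F}_N$ has a Hamilton cycle.
   Context: Let $N\geq 3$ and label the points of a convex $N$-gon by $1,\ldots,N$ in counterclockwise order. The associahedron $\mathcal{G}_N$ is the graph whose nodes are all triangulations of the convex $N$-gon, with an edge between two triangulations if they differ in a flip; a flip removes an edge (diagonal) shared by two triangles and replaces it by the other diagonal of the resulting quadrilateral. Color point $i$ red if $i$ is odd and blue if $i$ is even. A triangulation is colorful if no triangle has all three of its points of the same color. $\mathcal{F}_N$ denotes the subgraph of $\mathcal{G}_N$ induced by all colorful triangulations. *)

theory Defs
  imports Main
begin

text \<open>Simple graphs are pairs of a vertex set and a set of two-element edges.\<close>

type_synonym 'a sgraph = "'a set \<times> 'a set set"

definition induced_sgraph :: "'a sgraph \<Rightarrow> 'a set \<Rightarrow> 'a sgraph" where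
  "induced_sgraph G W = (fst G \<inter> W, {e \<in> snd G. e \<subseteq> W})"

definition hamilton_cycle :: "'a sgraph \<Rightarrow> 'a list \<Rightarrow> bool" where
  "hamilton_cycle G xs \<longleftrightarrow>
     3 \<le> length xs \<and> distinct xs \<and> set xs = fst G \<and>
     (\<forall>i < length xs. {xs ! i, xs ! (Suc i mod length xs)} \<in> snd G)"

definition has_hamilton_cycle :: "'a sgraph \<Rightarrow> bool" where
  "has_hamilton_cycle G \<longleftrightarrow> (\<exists>xs. hamilton_cycle G xs)"

text \<open>The convex polygon on the points \<open>1, \<dots>, N\<close> is treated combinatorially: a segment is
  the set of its two endpoints.\<close>

definition polygon_sides :: "nat \<Rightarrow> nat set set" where
  "polygon_sides N = {{i, Suc i} | i. 1 \<le> i \<and> i < N} \<union> {{1, N}}"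

definition diagonals :: "nat \<Rightarrow> nat set set" where
  "diagonals N = {{i, j} | i j. i \<in> {1..N} \<and> j \<in> {1..N} \<and> i \<noteq> j} - polygon_sides N"

text \<open>Two segments between points in convex position meet in their relative interiors iff
  their four endpoints are distinct and alternate around the polygon.\<close>

definition crossing :: "nat set \<Rightarrow> nat set \<Rightarrow> bool" where
  "crossing e f \<longleftrightarrow>
     (\<exists>a b c d. a < b \<and> b < c \<and> c < d \<and>
        (e = {a, c} \<and> f = {b, d} \<or> e = {b, d} \<and> f = {a, c}))"

definition noncrossing :: "nat \<Rightarrow> nat set set \<Rightarrow> bool" where
  "noncrossing N D \<longleftrightarrow> D \<subseteq> diagonals N \<and> (\<forall>e \<in> D. \<forall>f \<in> D. \<not> crossing e f)"

text \<open>A triangulation is represented by its set of diagonals, without the polygon sides.\<close>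

definition triangulation :: "nat \<Rightarrow> nat set set \<Rightarrow> bool" where
  "triangulation N T \<longleftrightarrow>
     noncrossing N T \<and> (\<forall>D. noncrossing N D \<and> T \<subseteq> D \<longrightarrow> D = T)"

text \<open>For points in convex position, three points that are pairwise joined by segments of a
  triangulation always bound a face: any segment entering that triangle would cross one of its
  sides.\<close>

definition triangles :: "nat \<Rightarrow> nat set set \<Rightarrow> nat set set" where
  "triangles N T = {{a, b, c} | a b c. a \<noteq> b \<and> b \<noteq> c \<and> a \<noteq> c \<and>
     {a, b} \<in> T \<union> polygon_sides N \<and> {b, c} \<in> T \<union> polygon_sides N \<and>
     {a, c} \<in> T \<union> polygon_sides N}"

definition flip :: "nat \<Rightarrow> nat set set \<Rightarrow> nat set set \<Rightarrow> bool" where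
  "flip N T T' \<longleftrightarrow>
     (\<exists>a b c d. b \<noteq> d \<and> {a, c} \<in> T \<and>
        {a, b, c} \<in> triangles N T \<and> {a, c, d} \<in> triangles N T \<and>
        T' = insert {b, d} (T - {{a, c}}))"

definition associahedron :: "nat \<Rightarrow> nat set set sgraph" where
  "associahedron N =
     ({T. triangulation N T},
      {{T, T'} | T T'. triangulation N T \<and> triangulation N T' \<and> flip N T T'})"

datatype color = Red | Blue

definition point_color :: "nat \<Rightarrow> color" where
  "point_color i = (if odd i then Red else Blue)"

definition colorful :: "nat \<Rightarrow> nat set set \<Rightarrow> bool" where
  "colorful N T \<longleftrightarrow> (\<forall>t \<in> triangles N T. \<not> (\<exists>col. \<forall>i \<in> t. point_color i = col))"

definition colorful_associahedron :: "nat \<Rightarrow> nat set set sgraph" where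
  "colorful_associahedron N = induced_sgraph (associahedron N) {T. colorful N T}"

end

theory Submission
  imports Defs
begin

text \<open>In a colorful triangulation the diagonals with two colors cut the polygon into quadrangles
  (and, for odd \<open>N\<close>, one triangle at the monochromatic side), and each quadrangle carries one of its
  two monochromatic diagonals. The triangulations with a fixed dissection thus form a cube. A
  diagonal between two quadrangles can be flipped iff their monochromatic diagonals have different
  colors.

  Group the dissections by the sizes of the three parts cut off by the quadrangle at a root side.
  The triangulations over one dissection have a Hamilton cycle that uses all edges (rungs) in the
  direction of the root quadrangle and one further prescribed edge. Within a group these cycles are
  merged along rungs: if the quadrangles on one side of a diagonal are red and all others are blue,
  then this diagonal is the only one that can be flipped, so a rung that is needed for a new
  dissection has not been used before. The groups are finally merged along the prescribed
  edges, where each dissection has to serve at most once.\<close>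

section \<open>Triangulations as binary trees\<close>

text \<open>A flip within one of the three parts beyond the root quadrangle ignores which diagonal
  that quadrangle carries, so it lifts to two parallel edges. With two rungs these form a 4-cycle,
  and exchanging its opposite edges merges two cycles at the cost of one rung each. A flip that
  involves the root quadrangle depends on its state and changes the sizes of the parts; it is
  available at only one end of a rung. Its parallel copy has to come from toggling some quadrangle
  that is not involved, and this is what the prescribed edges are for. Hence the bound N \<ge> 8: it
  says that there are at least three quadrangles, whereas with only two a flip between them leaves
  none to toggle. For odd N the triangle at the monochromatic side is a second obstacle: it behaves
  like a quadrangle whose diagonal is always red, which breaks the symmetry between the
  colors.\<close>

datatype bt = Lf | Nd bt bt

fun lv :: "bt \<Rightarrow> nat" where
  "lv Lf = 1"
| "lv (Nd l r) = lv l + lv r"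

text \<open>The classical dual tree of a triangulation: inner nodes are triangles and each subtree
  contributes the segment that cuts it off. Sides and the root side are kept in the set, so that
  subtrees have the same form as the whole and triangles can be detected inside one set.\<close>

fun segs :: "nat \<Rightarrow> bt \<Rightarrow> (nat \<times> nat) set" where
  "segs i Lf = {(i, Suc i)}"
| "segs i (Nd l r) = insert (i, i + lv l + lv r) (segs i l \<union> segs (i + lv l) r)"

inductive rot :: "bt \<Rightarrow> bt \<Rightarrow> bool" where
  rot_root: "rot (Nd (Nd a b) c) (Nd a (Nd b c))"
| rot_left: "rot l l' \<Longrightarrow> rot (Nd l r) (Nd l' r)"
| rot_right: "rot r r' \<Longrightarrow> rot (Nd l r) (Nd l r')"

section \<open>Maximal noncrossing families of pairs and binary trees\<close>

fun crossing_pairs :: "nat \<times> nat \<Rightarrow> nat \<times> nat \<Rightarrow> bool" where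
  "crossing_pairs (a, c) (b, d) \<longleftrightarrow> a < b \<and> b < c \<and> c < d \<or> b < a \<and> a < d \<and> d < c"

definition pairs :: "nat \<Rightarrow> nat \<Rightarrow> (nat \<times> nat) set" where
  "pairs i j = {(p, q). i \<le> p \<and> p < q \<and> q \<le> j}"

text \<open>Maximality for families that include the sides: the pairs \<open>(k, Suc k)\<close> and
  \<open>(i, j)\<close> cross nothing in \<open>pairs i j\<close>, so they are forced into
  \<open>F\<close>.\<close>

definition saturated :: "nat \<Rightarrow> nat \<Rightarrow> (nat \<times> nat) set \<Rightarrow> bool" where
  "saturated i j F \<longleftrightarrow> F \<subseteq> pairs i j \<and> (\<forall>e\<in>F. \<forall>f\<in>F. \<not> crossing_pairs e f) \<and>
     (\<forall>e\<in>pairs i j. (\<forall>f\<in>F. \<not> crossing_pairs e f) \<longrightarrow> e \<in> F)"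

lemma lv_pos [simp]: "0 < lv t"
  by (induction t) auto

lemma lv_neq_0 [simp]: "lv t \<noteq> 0"
  using lv_pos[of t] by linarith

lemma segs_base: "(i, i + lv t) \<in> segs i t"
  by (cases t) auto

lemma segs_subset_pairs: "segs i t \<subseteq> pairs i (i + lv t)"
proof (induction t arbitrary: i)
  case Lf
  then show ?case by (auto simp: pairs_def)
next
  case (Nd l r)
  show ?case using Nd(1)[of i] Nd(2)[of "i + lv l"] lv_pos[of l] lv_pos[of r]
    by (fastforce simp: pairs_def)
qed

lemma segsD: "(p, q) \<in> segs i t \<Longrightarrow> i \<le> p \<and> p < q \<and> q \<le> i + lv t"
  using segs_subset_pairs[of i t] by (auto simp: pairs_def)

lemma segs_noncrossing: "\<lbrakk>e \<in> segs i t; f \<in> segs i t\<rbrakk> \<Longrightarrow> \<not> crossing_pairs e f"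
proof (induction t arbitrary: i)
  case Lf
  then show ?case by auto
next
  case (Nd l r)
  obtain p q where e: "e = (p, q)" by (cases e)
  obtain p' q' where f: "f = (p', q')" by (cases f)
  show ?case
    using Nd.prems Nd.IH(1)[of i] Nd.IH(2)[of "i + lv l"]
      segsD[of p q i l] segsD[of p q "i + lv l" r] segsD[of p' q' i l] segsD[of p' q' "i + lv l" r]
    unfolding e f by (simp only: segs.simps insert_iff Un_iff prod.inject crossing_pairs.simps) linarith
qed

lemma segs_maximal:
  assumes "(p, q) \<in> pairs i (i + lv t)" "\<And>f. f \<in> segs i t \<Longrightarrow> \<not> crossing_pairs (p, q) f"
  shows "(p, q) \<in> segs i t"
  using assms
proof (induction t arbitrary: i)
  case Lf
  then show ?case by (auto simp: pairs_def)
next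
  case (Nd l r)
  define m where "m = i + lv l"
  define j where "j = i + lv l + lv r"
  have j: "j = m + lv r" by (simp add: j_def m_def)
  have pq: "i \<le> p" "p < q" "q \<le> j" using Nd.prems(1) by (auto simp: pairs_def j_def)
  have "(i, m) \<in> segs i (Nd l r)" "(m, j) \<in> segs i (Nd l r)"
    using segs_base[of i l] segs_base[of m r] by (auto simp: m_def j_def)
  then have n: "\<not> crossing_pairs (p, q) (i, m)" "\<not> crossing_pairs (p, q) (m, j)"
    using Nd.prems(2) by blast+
  have "i < m" "m < j" by (auto simp: m_def j_def)
  \<comment> \<open>A pair with \<open>m\<close> strictly inside crosses \<open>(i, m)\<close>
    unless it starts at \<open>i\<close>, and crosses \<open>(m, j)\<close> unless it ends at
    \<open>j\<close>.\<close>
  then consider "q \<le> m" | "m \<le> p" | "p = i" "q = j"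
    using n pq by (simp only: crossing_pairs.simps) linarith
  then show ?case
  proof cases
    case 1
    then have "(p, q) \<in> segs i l" using Nd.IH(1)[of i] Nd.prems(2) pq
      by (simp add: pairs_def m_def)
    then show ?thesis by simp
  next
    case 2
    then have "(p, q) \<in> segs m r" using Nd.IH(2)[of m] Nd.prems(2) pq j
      by (simp add: pairs_def m_def)
    then show ?thesis by (simp add: m_def)
  next
    case 3
    then show ?thesis by (simp add: j_def)
  qed
qed

lemma saturated_segs: "saturated i (i + lv t) (segs i t)"
  unfolding saturated_def
proof (intro conjI ballI impI)
  fix e assume "e \<in> pairs i (i + lv t)" "\<forall>f\<in>segs i t. \<not> crossing_pairs e f"
  then show "e \<in> segs i t" by (cases e) (use segs_maximal in blast)
qed (use segs_subset_pairs segs_noncrossing in blast)+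

lemma saturated_imp_segs:
  assumes "saturated i j F" "i < j"
  shows "\<exists>t. lv t = j - i \<and> F = segs i t"
  using assms
proof (induction "j - i" arbitrary: i j F rule: less_induct)
  case less
  note sub = less.prems(1)[unfolded saturated_def, THEN conjunct1]
  note nc = less.prems(1)[unfolded saturated_def, THEN conjunct2, THEN conjunct1]
  note mx = less.prems(1)[unfolded saturated_def, THEN conjunct2, THEN conjunct2]
  have F: "i \<le> p \<and> p < q \<and> q \<le> j" if "(p, q) \<in> F" for p q
    using that sub by (auto simp: pairs_def)
  have base: "(i, j) \<in> F"
  proof -
    have "\<not> crossing_pairs (i, j) f" if "f \<in> F" for f
      using F[of "fst f" "snd f"] that by (cases f) auto
    then show ?thesis using mx less.prems(2) by (auto simp: pairs_def)
  qed
  show ?case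
  proof (cases "j = Suc i")
    case True
    then have "F = {(i, Suc i)}" using F base by fastforce
    then show ?thesis using True by (intro exI[of _ Lf]) simp
  next
    case False
    then have ij: "Suc i < j" using less.prems(2) by simp
    have "\<not> crossing_pairs (i, Suc i) f" for f
      by (cases f) auto
    then have "(i, Suc i) \<in> F" using mx ij by (auto simp: pairs_def)
    then have ex: "(i, Suc i) \<in> F \<and> Suc i < j" using ij by simp
    \<comment> \<open>The apex of the root triangle is the farthest neighbor of \<open>i\<close>
      before \<open>j\<close>. A pair crossing \<open>(m, j)\<close> must not cross
      \<open>(i, m)\<close>, so it would start at \<open>i\<close> and contradict the choice of
      \<open>m\<close>.\<close>
    define m where "m = (GREATEST m. (i, m) \<in> F \<and> m < j)"
    have m: "(i, m) \<in> F \<and> m < j"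
      unfolding m_def by (rule GreatestI_nat[of _ "Suc i" j]) (use ex in auto)
    have m_max: "k \<le> m" if "(i, k) \<in> F" "k < j" for k
      unfolding m_def by (rule Greatest_le_nat[of _ k j]) (use that in auto)
    have im: "i < m" using m F by blast
    have mj: "(m, j) \<in> F"
    proof -
      have "\<not> crossing_pairs (m, j) f" if f: "f \<in> F" for f
      proof -
        obtain p q where pq: "f = (p, q)" by (cases f)
        have "\<not> crossing_pairs (i, m) (p, q)" using nc m f pq by blast
        then show ?thesis using F[of p q] f pq m_max[of q] im m by (cases "p = i") auto
      qed
      then show ?thesis using mx m im by (auto simp: pairs_def)
    qed
    define F1 where "F1 = F \<inter> pairs i m"
    define F2 where "F2 = F \<inter> pairs m j"
    have cases_F: "f = (i, j) \<or> f \<in> F1 \<and> f \<in> pairs i m \<or> f \<in> F2 \<and> f \<in> pairs m j" if f: "f \<in> F" for f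
    proof -
      obtain p q where pq: "f = (p, q)" by (cases f)
      have "\<not> crossing_pairs (i, m) (p, q)" "\<not> crossing_pairs (m, j) (p, q)"
        using nc m mj f pq by blast+
      then show ?thesis using F[of p q] f pq im m unfolding F1_def F2_def pairs_def
        by auto
    qed
    have split: "F = insert (i, j) (F1 \<union> F2)"
    proof
      show "F \<subseteq> insert (i, j) (F1 \<union> F2)" using cases_F by blast
      show "insert (i, j) (F1 \<union> F2) \<subseteq> F" using base unfolding F1_def F2_def by blast
    qed
    have s1: "saturated i m F1"
      unfolding saturated_def
    proof (intro conjI ballI impI)
      fix e assume e: "e \<in> pairs i m" and n: "\<forall>f\<in>F1. \<not> crossing_pairs e f"
      have "\<not> crossing_pairs e f" if "f \<in> F" for f
        using cases_F[OF that] n e m by (cases e; cases f) (auto simp: pairs_def)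
      moreover have "e \<in> pairs i j" using e m by (auto simp: pairs_def)
      ultimately show "e \<in> F1" using mx e by (auto simp: F1_def)
    qed (use nc F1_def in auto)
    have s2: "saturated m j F2"
      unfolding saturated_def
    proof (intro conjI ballI impI)
      fix e assume e: "e \<in> pairs m j" and n: "\<forall>f\<in>F2. \<not> crossing_pairs e f"
      have "\<not> crossing_pairs e f" if "f \<in> F" for f
        using cases_F[OF that] n e im by (cases e; cases f) (auto simp: pairs_def)
      moreover have "e \<in> pairs i j" using e im by (auto simp: pairs_def)
      ultimately show "e \<in> F2" using mx e by (auto simp: F2_def)
    qed (use nc F2_def in auto)
    have less: "m - i < j - i" "j - m < j - i" using im m by auto
    obtain l where l: "lv l = m - i" "F1 = segs i l"
      using less.hyps[OF less(1) s1 im] by blast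
    obtain r where r: "lv r = j - m" "F2 = segs m r"
      using less.hyps[OF less(2) s2] m by blast
    have "F = segs i (Nd l r)" unfolding split using l r im m by simp
    then show ?thesis using l(1) r(1) im m by (intro exI[of _ "Nd l r"]) simp
  qed
qed

lemma segs_Nd_children:
  "segs i l = {(p, q) \<in> segs i (Nd l r). q \<le> i + lv l}"
  "segs (i + lv l) r = {(p, q) \<in> segs i (Nd l r). i + lv l \<le> p}"
  using lv_pos[of l] lv_pos[of r] by (auto dest: segsD)

text \<open>Two apices over the same root pair would produce crossing segments. Thus the set
  determines the root triangle and with it the split into subtrees.\<close>

lemma segs_Nd_apex:
  assumes "(i, k) \<in> segs i (Nd l r)" "(k, i + lv l + lv r) \<in> segs i (Nd l r)"
  shows "k = i + lv l"
proof -
  have b: "(i, i + lv l) \<in> segs i (Nd l r)" "(i + lv l, i + lv l + lv r) \<in> segs i (Nd l r)"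
    using segs_base[of i l] segs_base[of "i + lv l" r] by auto
  have "i < k" "k < i + lv l + lv r" using assms segsD by blast+
  then show ?thesis
    using segs_noncrossing[OF assms(1) b(2)] segs_noncrossing[OF b(1) assms(2)] by auto
qed

lemma segs_inj: "\<lbrakk>segs i t = segs i t'; lv t = lv t'\<rbrakk> \<Longrightarrow> t = t'"
proof (induction t arbitrary: i t')
  case Lf
  then show ?case by (cases t') (auto simp: add_is_1)
next
  case (Nd l r)
  show ?case
  proof (cases t')
    case Lf
    then show ?thesis using Nd.prems(2) lv_pos[of l] lv_pos[of r]
      by (simp add: add_is_1)
  next
    case t': (Nd l' r')
    have lv: "i + lv l' + lv r' = i + lv l + lv r" using Nd.prems(2) t' by simp
    have "(i, i + lv l') \<in> segs i t'" "(i + lv l', i + lv l' + lv r') \<in> segs i t'"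
      using segs_base[of i l'] segs_base[of "i + lv l'" r'] by (auto simp: t')
    then have "(i, i + lv l') \<in> segs i (Nd l r)" "(i + lv l', i + lv l + lv r) \<in> segs i (Nd l r)"
      unfolding Nd.prems(1) lv by auto
    then have "i + lv l' = i + lv l" by (rule segs_Nd_apex)
    then have eq: "lv l' = lv l" "lv r' = lv r" using Nd.prems(2) t' by auto
    have "segs i l = segs i l'"
      unfolding segs_Nd_children(1)[of i l r] segs_Nd_children(1)[of i l' r'] Nd.prems(1) t' eq ..
    moreover have "segs (i + lv l) r = segs (i + lv l') r'"
      unfolding segs_Nd_children(2)[of i l r] Nd.prems(1) t'
      unfolding eq(1)[symmetric]
      unfolding segs_Nd_children(2)[of i l' r'] ..
    ultimately have "l = l'" "r = r'"
      using Nd.IH(1)[of i l'] Nd.IH(2)[of "i + lv l" r'] unfolding eq by blast+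
    then show ?thesis using t' by simp
  qed
qed

lemma segs_Nd_triangle:
  assumes "(p, q) \<in> segs i (Nd l r)" "(q, s) \<in> segs i (Nd l r)" "(p, s) \<in> segs i (Nd l r)"
  shows "(p = i \<and> q = i + lv l \<and> s = i + lv l + lv r) \<or>
    {(p, q), (q, s), (p, s)} \<subseteq> segs i l \<or> {(p, q), (q, s), (p, s)} \<subseteq> segs (i + lv l) r"
proof -
  have lt: "i \<le> p" "p < q" "q < s" using assms segsD by blast+
  have "(p = i \<and> s = i + lv l + lv r) \<or> (p, s) \<in> segs i l \<or> (p, s) \<in> segs (i + lv l) r"
    using assms(3) by auto
  then show ?thesis
  proof (elim disjE)
    assume "p = i \<and> s = i + lv l + lv r"
    then show ?thesis using segs_Nd_apex[of i q l r] assms by auto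
  next
    assume a: "(p, s) \<in> segs i l"
    then have "s \<le> i + lv l" using segsD by blast
    then have "{(p, q), (q, s)} \<subseteq> segs i l"
      unfolding segs_Nd_children(1)[of i l r] using assms lt by (simp del: segs.simps)
    then show ?thesis using a by auto
  next
    assume a: "(p, s) \<in> segs (i + lv l) r"
    then have "i + lv l \<le> p" using segsD by blast
    then have "{(p, q), (q, s)} \<subseteq> segs (i + lv l) r"
      unfolding segs_Nd_children(2)[of i l r] using assms lt by (simp del: segs.simps)
    then show ?thesis using a by auto
  qed
qed

section \<open>Colorfulness and flips on trees\<close>

fun colorful_bt :: "(nat \<Rightarrow> bool) \<Rightarrow> nat \<Rightarrow> bt \<Rightarrow> bool" where
  "colorful_bt col i Lf = True"
| "colorful_bt col i (Nd l r) \<longleftrightarrow>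
     \<not> (col (i + lv l) = col i \<and> col (i + lv l + lv r) = col i) \<and>
     colorful_bt col i l \<and> colorful_bt col (i + lv l) r"

text \<open>Three pairwise joined positions are the root triangle or lie in one subtree
  (\<open>segs_Nd_triangle\<close>), so testing the root triangle of every node tests all of
  them.\<close>

lemma colorful_bt_iff:
  "colorful_bt col i t \<longleftrightarrow>
    (\<forall>p q s. (p, q) \<in> segs i t \<and> (q, s) \<in> segs i t \<and> (p, s) \<in> segs i t \<longrightarrow>
      \<not> (col q = col p \<and> col s = col p))"
proof (induction t arbitrary: i)
  case Lf
  then show ?case by auto
next
  case (Nd l r)
  let ?mono = "\<lambda>p q s. col q = col p \<and> col s = col p"
  have base: "(i, i + lv l) \<in> segs i (Nd l r)" "(i + lv l, i + lv l + lv r) \<in> segs i (Nd l r)"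
    "(i, i + lv l + lv r) \<in> segs i (Nd l r)"
    using segs_base[of i l] segs_base[of "i + lv l" r] by auto
  have sub: "e \<in> segs i l \<Longrightarrow> e \<in> segs i (Nd l r)" "e \<in> segs (i + lv l) r \<Longrightarrow> e \<in> segs i (Nd l r)" for e
    by auto
  show ?case
  proof
    assume c: "colorful_bt col i (Nd l r)"
    show "\<forall>p q s. (p, q) \<in> segs i (Nd l r) \<and> (q, s) \<in> segs i (Nd l r) \<and> (p, s) \<in> segs i (Nd l r)
      \<longrightarrow> \<not> ?mono p q s"
    proof (intro allI impI, elim conjE)
      fix p q s
      assume "(p, q) \<in> segs i (Nd l r)" "(q, s) \<in> segs i (Nd l r)" "(p, s) \<in> segs i (Nd l r)"
      from segs_Nd_triangle[OF this] show "\<not> ?mono p q s"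
        using c unfolding colorful_bt.simps Nd.IH insert_subset by blast
    qed
  next
    assume c: "\<forall>p q s. (p, q) \<in> segs i (Nd l r) \<and> (q, s) \<in> segs i (Nd l r) \<and> (p, s) \<in> segs i (Nd l r)
      \<longrightarrow> \<not> ?mono p q s"
    have "\<not> ?mono i (i + lv l) (i + lv l + lv r)" using c base by blast
    moreover have "colorful_bt col i l" "colorful_bt col (i + lv l) r"
      unfolding Nd.IH using c sub by blast+
    ultimately show "colorful_bt col i (Nd l r)" by simp
  qed
qed

text \<open>Only the flip that removes the diagonal at the smallest corner, which is a right
  rotation; the opposite flip is covered because edges are unordered.\<close>

definition flip_pairs :: "(nat \<times> nat) set \<Rightarrow> (nat \<times> nat) set \<Rightarrow> bool" where
  "flip_pairs F F' \<longleftrightarrow> (\<exists>i x y z. i < x \<and> x < y \<and> y < z \<and>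
     {(i, x), (x, y), (y, z), (i, z), (i, y)} \<subseteq> F \<and> F' = insert (x, z) (F - {(i, y)}))"

lemma flip_pairs_Un:
  assumes "flip_pairs F F'" "\<And>p q. \<lbrakk>(p, q) \<in> F; Suc p < q\<rbrakk> \<Longrightarrow> \<exists>z. (p, z) \<in> F \<and> q < z \<Longrightarrow> (p, q) \<notin> G"
  shows "flip_pairs (F \<union> G) (F' \<union> G)"
proof -
  obtain i x y z where *: "i < x" "x < y" "y < z" "{(i, x), (x, y), (y, z), (i, z), (i, y)} \<subseteq> F"
    "F' = insert (x, z) (F - {(i, y)})"
    using assms(1) unfolding flip_pairs_def by blast
  then have "(i, y) \<notin> G" using assms(2)[of i y] by auto
  then have "F' \<union> G = insert (x, z) ((F \<union> G) - {(i, y)})" using * by auto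
  then show ?thesis unfolding flip_pairs_def using * by blast
qed

lemma rot_lv: "rot t t' \<Longrightarrow> lv t = lv t'"
  by (induction rule: rot.induct) auto

lemma rot_flip_pairs: "rot t t' \<Longrightarrow> flip_pairs (segs i t) (segs i t')"
proof (induction arbitrary: i rule: rot.induct)
  case (rot_root a b c)
  let ?x = "i + lv a" and ?y = "i + lv a + lv b" and ?z = "i + lv a + lv b + lv c"
  have "(i, ?y) \<notin> segs i a" "(i, ?y) \<notin> segs ?x b" "(i, ?y) \<notin> segs ?y c"
    using segsD[of i ?y i a] segsD[of i ?y ?x b] segsD[of i ?y ?y c] lv_pos[of a] lv_pos[of b]
    by (auto)
  then have "segs i (Nd a (Nd b c)) = insert (?x, ?z) (segs i (Nd (Nd a b) c) - {(i, ?y)})"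
    using lv_pos[of a] lv_pos[of b] lv_pos[of c] by (auto simp: add.assoc)
  moreover have "{(i, ?x), (?x, ?y), (?y, ?z), (i, ?z), (i, ?y)} \<subseteq> segs i (Nd (Nd a b) c)"
    using segs_base[of i a] segs_base[of ?x b] segs_base[of ?y c] by (auto simp: add.assoc)
  moreover have "i < ?x" "?x < ?y" "?y < ?z" by auto
  ultimately show ?case unfolding flip_pairs_def by blast
next
  case (rot_left l l' r)
  have lv: "lv l = lv l'" using rot_left rot_lv by blast
  have "flip_pairs (segs i l \<union> insert (i, i + lv l + lv r) (segs (i + lv l) r))
    (segs i l' \<union> insert (i, i + lv l + lv r) (segs (i + lv l) r))"
    by (rule flip_pairs_Un[OF rot_left.IH]) (use lv_pos[of r] in \<open>fastforce dest!: segsD\<close>)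
  then show ?case using lv by simp
next
  case (rot_right r r' l)
  have lv: "lv r = lv r'" using rot_right rot_lv by blast
  have "flip_pairs (segs (i + lv l) r \<union> insert (i, i + lv l + lv r) (segs i l))
    (segs (i + lv l) r' \<union> insert (i, i + lv l + lv r) (segs i l))"
    by (rule flip_pairs_Un[OF rot_right.IH]) (use lv_pos[of l] in \<open>fastforce dest!: segsD\<close>)
  then show ?case using lv by (simp add: Un_commute)
qed

text \<open>The polygon is cut open at its side \<open>{N - 1, N}\<close>: position \<open>0\<close> carries the label \<open>N\<close>. In
  this way the root side has two colors for both parities of \<open>N\<close>, and for odd \<open>N\<close> the
  only monochromatic side \<open>{1, N}\<close> joins the positions \<open>0\<close> and \<open>1\<close>.\<close>

definition label :: "nat \<Rightarrow> nat \<Rightarrow> nat" where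
  "label N i = (if i = 0 then N else i)"

definition seg :: "nat \<Rightarrow> nat \<times> nat \<Rightarrow> nat set" where
  "seg N e = {label N (fst e), label N (snd e)}"

definition diags :: "nat \<Rightarrow> (nat \<times> nat) set \<Rightarrow> nat set set" where
  "diags N F = seg N ` F - polygon_sides N"

definition side_pairs :: "nat \<Rightarrow> (nat \<times> nat) set" where
  "side_pairs N = insert (0, N - 1) {(k, Suc k) | k. Suc k < N}"

section \<open>Transfer from positions to the labels of the polygon\<close>

lemma label_inj: "\<lbrakk>label N p = label N q; p < N; q < N\<rbrakk> \<Longrightarrow> p = q"
  by (auto simp: label_def split: if_splits)

lemma seg_inj: "\<lbrakk>seg N e = seg N f; e \<in> pairs 0 (N - 1); f \<in> pairs 0 (N - 1); 0 < N\<rbrakk> \<Longrightarrow> e = f"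
  by (cases e; cases f) (auto simp: seg_def label_def pairs_def doubleton_eq_iff split: if_splits)

lemma seg_mem_iff:
  assumes "F \<subseteq> pairs 0 (N - 1)" "e \<in> pairs 0 (N - 1)" "0 < N"
  shows "seg N e \<in> seg N ` F \<longleftrightarrow> e \<in> F"
  using assms seg_inj[of N e] by auto

lemma polygon_sides_eq:
  assumes "3 \<le> N"
  shows "polygon_sides N = seg N ` side_pairs N"
proof
  show "polygon_sides N \<subseteq> seg N ` side_pairs N"
  proof
    fix e assume "e \<in> polygon_sides N"
    then consider i where "e = {i, Suc i}" "1 \<le> i" "Suc i < N" | "e = {N - 1, N}" | "e = {1, N}"
      unfolding polygon_sides_def using assms
      by (smt (verit) CollectD Suc_lessI UnE diff_Suc_1 mem_Collect_eq singletonD)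
    then show "e \<in> seg N ` side_pairs N"
    proof cases
      case 1
      then show ?thesis
        by (intro image_eqI[of _ _ "(i, Suc i)"]) (auto simp: seg_def label_def side_pairs_def)
    next
      case 2
      then show ?thesis using assms
        by (intro image_eqI[of _ _ "(0, N - 1)"]) (auto simp: seg_def label_def side_pairs_def)
    next
      case 3
      then show ?thesis using assms
        by (intro image_eqI[of _ _ "(0, Suc 0)"]) (auto simp: seg_def label_def side_pairs_def)
    qed
  qed
  have a: "{N, N - Suc 0} \<in> polygon_sides N"
    unfolding polygon_sides_def using assms by (intro UnI1 CollectI exI[of _ "N - 1"]) auto
  have b: "{N, Suc 0} \<in> polygon_sides N" unfolding polygon_sides_def by auto
  have c: "{k, Suc k} \<in> polygon_sides N" if "0 < k" "k < N" for k
    unfolding polygon_sides_def using that by (intro UnI1 CollectI exI[of _ k]) auto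
  show "seg N ` side_pairs N \<subseteq> polygon_sides N"
    using a b c assms by (auto simp: seg_def label_def side_pairs_def)
qed

lemma segments_eq:
  assumes "3 \<le> N"
  shows "{{i, j} | i j. i \<in> {1..N} \<and> j \<in> {1..N} \<and> i \<noteq> j} = seg N ` pairs 0 (N - 1)"
proof
  show "{{i, j} | i j. i \<in> {1..N} \<and> j \<in> {1..N} \<and> i \<noteq> j} \<subseteq> seg N ` pairs 0 (N - 1)"
  proof clarify
    fix i j assume ij: "i \<in> {1..N}" "j \<in> {1..N}" "i \<noteq> j"
    define p where "p = (if i = N then 0 else i)"
    define q where "q = (if j = N then 0 else j)"
    have "{i, j} = seg N (min p q, max p q)" "p \<noteq> q" "p < N" "q < N"
      using ij by (auto simp: p_def q_def seg_def label_def min_def max_def)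
    then show "{i, j} \<in> seg N ` pairs 0 (N - 1)"
      by (intro image_eqI[of _ _ "(min p q, max p q)"]) (auto simp: pairs_def min_def max_def)
  qed
  show "seg N ` pairs 0 (N - 1) \<subseteq> {{i, j} | i j. i \<in> {1..N} \<and> j \<in> {1..N} \<and> i \<noteq> j}"
  proof clarify
    fix p q assume "(p, q) \<in> pairs 0 (N - 1)"
    then have "label N p \<in> {1..N}" "label N q \<in> {1..N}" "label N p \<noteq> label N q"
      using assms by (auto simp: pairs_def label_def)
    then show "\<exists>i j. seg N (p, q) = {i, j} \<and> i \<in> {1..N} \<and> j \<in> {1..N} \<and> i \<noteq> j"
      by (auto simp: seg_def)
  qed
qed

lemma crossing_seg_iff:
  assumes "e \<in> pairs 0 (N - 1)" "f \<in> pairs 0 (N - 1)" "3 \<le> N"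
  shows "crossing (seg N e) (seg N f) \<longleftrightarrow> crossing_pairs e f"
proof -
  obtain p q r s where [simp]: "e = (p, q)" "f = (r, s)" by (cases e; cases f)
  have *: "p < q" "q < N" "r < s" "s < N" using assms by (auto simp: pairs_def)
  show ?thesis
  proof
    assume "crossing (seg N e) (seg N f)"
    then obtain a b c d where "a < b" "b < c" "c < d"
      "seg N e = {a, c} \<and> seg N f = {b, d} \<or> seg N e = {b, d} \<and> seg N f = {a, c}"
      unfolding crossing_def by blast
    then show "crossing_pairs e f" using *
      by (auto simp: seg_def label_def doubleton_eq_iff split: if_splits)
  next
    \<comment> \<open>Relabeling position 0 as \<open>N\<close> moves the smallest endpoint to the
      upper end of the order; alternation is a cyclic property and survives this.\<close>
    have key: "crossing {label N a, c} {b, d} \<and> crossing {b, d} {label N a, c}"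
      if "a < b" "b < c" "c < d" "d < N" for a b c d
    proof (cases "a = 0")
      case True
      have "b < c" "c < d" "d < N" "{label N a, c} = {c, N}"
        using that True by (auto simp: label_def)
      then show ?thesis unfolding crossing_def by metis
    next
      case False
      then have "label N a = a" by (simp add: label_def)
      then show ?thesis unfolding crossing_def using that by metis
    qed
    assume "crossing_pairs e f"
    then consider "p < r" "r < q" "q < s" | "r < p" "p < s" "s < q" by auto
    then show "crossing (seg N e) (seg N f)"
    proof cases
      case 1
      then show ?thesis using key[of p r q s] * by (auto simp: seg_def label_def)
    next
      case 2
      then show ?thesis using key[of r p s q] * by (auto simp: seg_def label_def)
    qed
  qed
qed

lemma side_pairs_subset: "3 \<le> N \<Longrightarrow> side_pairs N \<subseteq> pairs 0 (N - 1)"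
  by (auto simp: side_pairs_def pairs_def)

lemma side_pairs_not_crossing:
  assumes "e \<in> side_pairs N" "f \<in> pairs 0 (N - 1)"
  shows "\<not> crossing_pairs e f" "\<not> crossing_pairs f e"
  using assms by (cases f; auto simp: side_pairs_def pairs_def)+

lemma saturated_side_pairs:
  assumes "saturated 0 (N - 1) F" "3 \<le> N"
  shows "side_pairs N \<subseteq> F"
proof
  fix e assume e: "e \<in> side_pairs N"
  then have "e \<in> pairs 0 (N - 1)" using side_pairs_subset[OF assms(2)] by blast
  moreover have "\<forall>f\<in>F. \<not> crossing_pairs e f"
    using side_pairs_not_crossing(1)[OF e] assms(1) unfolding saturated_def by blast
  ultimately show "e \<in> F" using assms(1) unfolding saturated_def by blast
qed

lemma diagonals_eq: "3 \<le> N \<Longrightarrow> diagonals N = seg N ` pairs 0 (N - 1) - polygon_sides N"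
  unfolding diagonals_def segments_eq ..

lemma triangulation_diags:
  assumes F: "saturated 0 (N - 1) F" and N: "3 \<le> N"
  shows "triangulation N (diags N F)"
proof -
  note sub = F[unfolded saturated_def, THEN conjunct1]
  note nc = F[unfolded saturated_def, THEN conjunct2, THEN conjunct1]
  note mx = F[unfolded saturated_def, THEN conjunct2, THEN conjunct2]
  have "noncrossing N (diags N F)"
    unfolding noncrossing_def diags_def diagonals_eq[OF N]
    using sub nc crossing_seg_iff N by blast
  moreover have "D \<subseteq> diags N F" if D: "noncrossing N D" "diags N F \<subseteq> D" for D
  proof
    fix x assume x: "x \<in> D"
    then obtain e where e: "x = seg N e" "e \<in> pairs 0 (N - 1)" "x \<notin> polygon_sides N"
      using D(1) unfolding noncrossing_def diagonals_eq[OF N] by blast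
    have "\<not> crossing_pairs e f" if f: "f \<in> F" for f
    proof (cases "seg N f \<in> polygon_sides N")
      case True
      then have "f \<in> side_pairs N" using seg_mem_iff[OF side_pairs_subset[OF N], of f] f sub N
        unfolding polygon_sides_eq[OF N] by auto
      then show ?thesis using side_pairs_not_crossing e by blast
    next
      case False
      then have "seg N f \<in> D" using f D(2) unfolding diags_def by blast
      then show ?thesis using D(1) x e crossing_seg_iff[of e N f] f sub N
        unfolding noncrossing_def by blast
    qed
    then have "e \<in> F" using mx e by blast
    then show "x \<in> diags N F" using e by (auto simp: diags_def)
  qed
  ultimately show ?thesis unfolding triangulation_def by blast
qed

lemma triangulation_imp_saturated:
  assumes T: "triangulation N T" and N: "3 \<le> N"
  shows "\<exists>F. saturated 0 (N - 1) F \<and> T = diags N F"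
proof -
  define F where "F = {e \<in> pairs 0 (N - 1). seg N e \<in> T \<union> polygon_sides N}"
  have nT: "noncrossing N T" using T by (simp add: triangulation_def)
  have T': "T \<subseteq> seg N ` pairs 0 (N - 1) - polygon_sides N"
    using nT unfolding noncrossing_def diagonals_eq[OF N] by blast
  have side: "e \<in> side_pairs N" if "seg N e \<in> polygon_sides N" "e \<in> pairs 0 (N - 1)" for e
    using that seg_mem_iff[OF side_pairs_subset[OF N], of e] N unfolding polygon_sides_eq[OF N] by simp
  have "saturated 0 (N - 1) F"
    unfolding saturated_def
  proof (intro conjI ballI impI)
    show "F \<subseteq> pairs 0 (N - 1)" by (auto simp: F_def)
    fix e f assume ef: "e \<in> F" "f \<in> F"
    then have p: "e \<in> pairs 0 (N - 1)" "f \<in> pairs 0 (N - 1)" by (auto simp: F_def)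
    show "\<not> crossing_pairs e f"
    proof (cases "seg N e \<in> T \<and> seg N f \<in> T")
      case True
      then show ?thesis using nT crossing_seg_iff[OF p N] unfolding noncrossing_def by blast
    next
      case False
      then have "e \<in> side_pairs N \<or> f \<in> side_pairs N" using ef side p unfolding F_def by blast
      then show ?thesis using side_pairs_not_crossing p by blast
    qed
  next
    fix e assume e: "e \<in> pairs 0 (N - 1)" "\<forall>f\<in>F. \<not> crossing_pairs e f"
    have "seg N e \<in> T" if "seg N e \<notin> polygon_sides N"
    proof -
      have ce: "\<not> crossing (seg N e) (seg N e)"
        using crossing_seg_iff[OF e(1) e(1) N] by (cases e) auto
      have "\<not> crossing (seg N e) t \<and> \<not> crossing t (seg N e)" if t: "t \<in> T" for t
      proof -
        obtain f where f: "t = seg N f" "f \<in> pairs 0 (N - 1)" using T' t by blast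
        then have "f \<in> F" using t by (simp add: F_def)
        then have "\<not> crossing_pairs e f" using e by blast
        moreover from this have "\<not> crossing_pairs f e" by (cases e; cases f) auto
        ultimately show ?thesis using crossing_seg_iff e f N by blast
      qed
      then have "noncrossing N (insert (seg N e) T)"
        using nT e(1) ce that unfolding noncrossing_def diagonals_eq[OF N] by blast
      then show ?thesis using T unfolding triangulation_def by blast
    qed
    then show "e \<in> F" using e by (auto simp: F_def)
  qed
  moreover have "T = diags N F"
    using T' by (auto simp: diags_def F_def)
  ultimately show ?thesis by blast
qed

definition tri :: "nat \<Rightarrow> bt \<Rightarrow> nat set set" where
  "tri N t = diags N (segs 0 t)"

lemma saturated_tri: "lv t = N - 1 \<Longrightarrow> saturated 0 (N - 1) (segs 0 t)"
  using saturated_segs[of 0 t] by simp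

lemma triangulation_iff_tri:
  assumes "3 \<le> N"
  shows "triangulation N T \<longleftrightarrow> (\<exists>t. lv t = N - 1 \<and> T = tri N t)"
proof
  assume "triangulation N T"
  then obtain F where F: "saturated 0 (N - 1) F" "T = diags N F"
    using triangulation_imp_saturated assms by blast
  then show "\<exists>t. lv t = N - 1 \<and> T = tri N t"
    using saturated_imp_segs[OF F(1)] assms by (auto simp: tri_def)
qed (use triangulation_diags saturated_tri assms in \<open>auto simp: tri_def\<close>)

lemma tri_Un_sides:
  assumes "3 \<le> N" "lv t = N - 1"
  shows "tri N t \<union> polygon_sides N = seg N ` segs 0 t"
  using saturated_side_pairs[OF saturated_tri[OF assms(2)] assms(1)]
  unfolding tri_def diags_def polygon_sides_eq[OF assms(1)] by blast

lemma segs_pairs: "lv t = N - 1 \<Longrightarrow> segs 0 t \<subseteq> pairs 0 (N - 1)"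
  using segs_subset_pairs[of 0 t] by simp

lemma tri_inj:
  assumes "3 \<le> N" "lv t = N - 1" "lv t' = N - 1" "tri N t = tri N t'"
  shows "t = t'"
proof -
  have eq: "seg N ` segs 0 t = seg N ` segs 0 t'"
    using tri_Un_sides assms by metis
  have "e \<in> segs 0 t \<longleftrightarrow> e \<in> segs 0 t'" if "e \<in> pairs 0 (N - 1)" for e
    using seg_mem_iff[OF segs_pairs[OF assms(2)] that] seg_mem_iff[OF segs_pairs[OF assms(3)] that]
      eq assms(1) by simp
  then have "segs 0 t = segs 0 t'" using segs_pairs assms by blast
  then show ?thesis using segs_inj assms by metis
qed

lemma seg_pair: "seg N (p, q) = {label N p, label N q}"
  by (simp add: seg_def)

lemma triangle_tri:
  assumes "3 \<le> N" "lv t = N - 1" "(p, q) \<in> segs 0 t" "(q, s) \<in> segs 0 t" "(p, s) \<in> segs 0 t"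
  shows "{label N p, label N q, label N s} \<in> triangles N (tri N t)"
proof -
  have "p < q" "q < s" "s < N" using segsD[OF assms(3)] segsD[OF assms(4)] assms by auto
  then have "label N p \<noteq> label N q" "label N q \<noteq> label N s" "label N p \<noteq> label N s"
    by (auto simp: label_def)
  moreover have "{label N p, label N q} \<in> seg N ` segs 0 t" "{label N q, label N s} \<in> seg N ` segs 0 t"
    "{label N p, label N s} \<in> seg N ` segs 0 t"
    using assms seg_pair by blast+
  ultimately show ?thesis unfolding triangles_def tri_Un_sides[OF assms(1,2)] by blast
qed

lemma triangles_triD:
  assumes "3 \<le> N" "lv t = N - 1" "A \<in> triangles N (tri N t)"
  shows "\<exists>p q s. A = {label N p, label N q, label N s} \<and>
    (p, q) \<in> segs 0 t \<and> (q, s) \<in> segs 0 t \<and> (p, s) \<in> segs 0 t"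
proof -
  \<comment> \<open>Polygon triangles are unordered sets of labels. A symmetric relation on
    positions allows the corners to be sorted afterwards.\<close>
  define adj where "adj p q \<longleftrightarrow> (p, q) \<in> segs 0 t \<or> (q, p) \<in> segs 0 t" for p q
  have ex: "\<exists>p q. a = label N p \<and> b = label N q \<and> adj p q \<and> p < N \<and> q < N"
    if ab: "{a, b} \<in> seg N ` segs 0 t" for a b
  proof -
    obtain p q where pq: "(p, q) \<in> segs 0 t" "{a, b} = {label N p, label N q}"
      using ab by (auto simp: seg_def)
    have "p < N" "q < N" using segsD[OF pq(1)] assms(1,2) by auto
    then show ?thesis using pq unfolding doubleton_eq_iff adj_def by blast
  qed
  obtain a b c where A: "A = {a, b, c}"
    and s: "{a, b} \<in> seg N ` segs 0 t" "{b, c} \<in> seg N ` segs 0 t" "{a, c} \<in> seg N ` segs 0 t"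
    using assms(3) unfolding triangles_def tri_Un_sides[OF assms(1,2)] by blast
  obtain x y z where xyz: "a = label N x" "b = label N y" "c = label N z"
    and adj: "adj x y" "adj y z" "adj x z"
    using ex[OF s(1)] ex[OF s(2)] ex[OF s(3)] label_inj[of N] by metis
  have lt: "(p, q) \<in> segs 0 t" if "adj p q" "p < q" for p q
    using that segsD[of q p 0 t] unfolding adj_def by auto
  have sorted: ?thesis if "A = {label N p, label N q, label N s}" "adj p q" "adj q s" "adj p s" "p < q" "q < s" for p q s
    using that(1) lt[OF that(2,5)] lt[OF that(3,6)] lt[OF that(4) less_trans[OF that(5,6)]] by blast
  have "x \<noteq> y" "y \<noteq> z" "x \<noteq> z" using adj segsD[of _ _ 0 t] unfolding adj_def by (metis less_irrefl)+
  then consider "x < y \<and> y < z" | "x < z \<and> z < y" | "y < x \<and> x < z" | "y < z \<and> z < x"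
    | "z < x \<and> x < y" | "z < y \<and> y < x"
    by linarith
  moreover have "adj y x" "adj z y" "adj z x" using adj unfolding adj_def by blast+
  ultimately show ?thesis
    using sorted[of x y z] sorted[of x z y] sorted[of y x z] sorted[of y z x] sorted[of z x y]
      sorted[of z y x] adj A xyz by cases (simp_all add: insert_commute)
qed

definition pos_color :: "nat \<Rightarrow> nat \<Rightarrow> bool" where
  "pos_color N i = odd (label N i)"

lemma colorful_tri_iff:
  assumes "3 \<le> N" "lv t = N - 1"
  shows "colorful N (tri N t) \<longleftrightarrow> colorful_bt (pos_color N) 0 t"
proof -
  have mono: "(\<exists>col. \<forall>i\<in>{label N p, label N q, label N s}. point_color i = col) \<longleftrightarrow>
    pos_color N q = pos_color N p \<and> pos_color N s = pos_color N p" for p q s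
    by (auto simp: point_color_def pos_color_def)
  show ?thesis
  proof
    assume c: "colorful N (tri N t)"
    show "colorful_bt (pos_color N) 0 t"
      unfolding colorful_bt_iff
    proof (intro allI impI, elim conjE)
      fix p q s assume "(p, q) \<in> segs 0 t" "(q, s) \<in> segs 0 t" "(p, s) \<in> segs 0 t"
      from c[unfolded colorful_def, rule_format, OF triangle_tri[OF assms this]]
      show "\<not> (pos_color N q = pos_color N p \<and> pos_color N s = pos_color N p)"
        unfolding mono .
    qed
  next
    assume c: "colorful_bt (pos_color N) 0 t"
    show "colorful N (tri N t)" unfolding colorful_def
    proof
      fix A assume "A \<in> triangles N (tri N t)"
      then obtain p q s where A: "A = {label N p, label N q, label N s}"
        and F: "(p, q) \<in> segs 0 t" "(q, s) \<in> segs 0 t" "(p, s) \<in> segs 0 t"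
        using triangles_triD[OF assms] by blast
      show "\<not> (\<exists>col. \<forall>i\<in>A. point_color i = col)"
        unfolding A mono using c F unfolding colorful_bt_iff by blast
    qed
  qed
qed

lemma flip_tri:
  assumes "3 \<le> N" "lv t = N - 1" "rot t t'"
  shows "flip N (tri N t) (tri N t')"
proof -
  obtain i x y z where ord: "i < x" "x < y" "y < z"
    and F: "{(i, x), (x, y), (y, z), (i, z), (i, y)} \<subseteq> segs 0 t"
    and F': "segs 0 t' = insert (x, z) (segs 0 t - {(i, y)})"
    using rot_flip_pairs[OF assms(3), of 0] unfolding flip_pairs_def by (elim exE conjE) (rule that)
  have zN: "z < N" using F segsD[of i z 0 t] assms by auto
  have inP: "(i, y) \<in> pairs 0 (N - 1)" "(x, z) \<in> pairs 0 (N - 1)" using ord zN by (auto simp: pairs_def)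
  have "(i, y) \<notin> side_pairs N" "(x, z) \<notin> side_pairs N" using ord zN by (auto simp: side_pairs_def)
  then have ns: "seg N (i, y) \<notin> polygon_sides N" "seg N (x, z) \<notin> polygon_sides N"
    using seg_mem_iff[OF side_pairs_subset[OF assms(1)]] inP assms(1)
    unfolding polygon_sides_eq[OF assms(1)] by auto
  have "seg N e \<noteq> seg N (i, y)" if "e \<in> segs 0 t - {(i, y)}" for e
    using that seg_inj[of N e "(i, y)"] inP segs_pairs[OF assms(2)] assms(1) by auto
  then have "seg N ` segs 0 t' = insert (seg N (x, z)) (seg N ` segs 0 t - {seg N (i, y)})"
    unfolding F' by auto
  then have "tri N t' = insert {label N x, label N z} (tri N t - {{label N i, label N y}})"
    unfolding tri_def diags_def using ns by (auto simp: seg_pair)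
  moreover have "{label N i, label N y} \<in> tri N t"
    unfolding tri_def diags_def using ns(1) F by (auto simp flip: seg_pair)
  moreover have "{label N i, label N x, label N y} \<in> triangles N (tri N t)"
    using triangle_tri[OF assms(1,2), of i x y] F by auto
  moreover have "{label N i, label N y, label N z} \<in> triangles N (tri N t)"
    using triangle_tri[OF assms(1,2), of i y z] F by auto
  moreover have "label N x \<noteq> label N z" using label_inj[of N x z] ord zN by auto
  ultimately show ?thesis
    unfolding flip_def
    by (intro exI[of _ "label N i"] exI[of _ "label N x"] exI[of _ "label N y"] exI[of _ "label N z"] conjI)
qed

section \<open>Gluing cycles\<close>

fun path_edges :: "'a list \<Rightarrow> 'a set set" where
  "path_edges (x # y # xs) = insert {x, y} (path_edges (y # xs))"
| "path_edges _ = {}"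

definition cycle_edges :: "'a list \<Rightarrow> 'a set set" where
  "cycle_edges xs = insert {last xs, hd xs} (path_edges xs)"

text \<open>\<open>M\<close> is a set of edges that the cycle is known to traverse; these are the ones along which
  it can still be glued to other cycles.\<close>

definition cyclic :: "'a set set \<Rightarrow> 'a set \<Rightarrow> 'a set set \<Rightarrow> bool" where
  "cyclic E V M \<longleftrightarrow> (\<exists>xs. distinct xs \<and> set xs = V \<and> 3 \<le> length xs \<and>
     cycle_edges xs \<subseteq> E \<and> M \<subseteq> cycle_edges xs)"

lemma path_edges_append:
  "\<lbrakk>xs \<noteq> []; ys \<noteq> []\<rbrakk> \<Longrightarrow>
    path_edges (xs @ ys) = insert {last xs, hd ys} (path_edges xs \<union> path_edges ys)"
proof (induction xs rule: path_edges.induct)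
  case (1 x y xs)
  then show ?case by auto
next
  case ("2_2" x)
  then show ?case by (cases ys) auto
qed simp

lemma path_edges_rev: "path_edges (rev xs) = path_edges xs"
proof (induction xs rule: path_edges.induct)
  case (1 x y xs)
  have "path_edges (rev (y # xs) @ [x]) = insert {y, x} (path_edges (rev (y # xs)))"
    by (subst path_edges_append) (auto simp: last_rev)
  then show ?case using 1 by (simp add: insert_commute)
qed simp_all

lemma cycle_edges_rev: "xs \<noteq> [] \<Longrightarrow> cycle_edges (rev xs) = cycle_edges xs"
  by (simp add: cycle_edges_def path_edges_rev hd_rev last_rev insert_commute)

lemma path_edges_split:
  "e \<in> path_edges xs \<Longrightarrow> \<exists>as bs. xs = as @ bs \<and> as \<noteq> [] \<and> bs \<noteq> [] \<and> e = {last as, hd bs}"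
proof (induction xs rule: path_edges.induct)
  case (1 x y xs)
  show ?case
  proof (cases "e = {x, y}")
    case True
    then show ?thesis by (intro exI[of _ "[x]"] exI[of _ "y # xs"]) simp
  next
    case False
    then obtain as bs where "y # xs = as @ bs" "as \<noteq> []" "bs \<noteq> []" "e = {last as, hd bs}"
      using 1 by auto
    then show ?thesis by (intro exI[of _ "x # as"] exI[of _ bs]) simp
  qed
qed simp_all

text \<open>A list is a cycle cut open at the edge between its ends. Rotation, and reversal if
  needed, moves the cut to any edge, after which gluing is concatenation.\<close>

lemma cycle_open_at_edge:
  assumes "{u, v} \<in> cycle_edges xs" "xs \<noteq> []" "distinct xs"
  shows "\<exists>ys. distinct ys \<and> set ys = set xs \<and> length ys = length xs \<and>
    cycle_edges ys = cycle_edges xs \<and> hd ys = u \<and> last ys = v"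
proof -
  have "\<exists>ys. distinct ys \<and> set ys = set xs \<and> length ys = length xs \<and>
    cycle_edges ys = cycle_edges xs \<and> {u, v} = {hd ys, last ys}"
  proof (cases "{u, v} = {last xs, hd xs}")
    case True
    then show ?thesis using assms by (intro exI[of _ xs]) (simp add: insert_commute)
  next
    case False
    then have "{u, v} \<in> path_edges xs" using assms by (simp add: cycle_edges_def)
    then obtain as bs where s: "xs = as @ bs" "as \<noteq> []" "bs \<noteq> []" "{u, v} = {last as, hd bs}"
      using path_edges_split by blast
    then have "cycle_edges (bs @ as) = cycle_edges xs"
      by (simp add: cycle_edges_def path_edges_append insert_commute Un_commute)
    then show ?thesis using s assms by (intro exI[of _ "bs @ as"]) (auto simp: insert_commute)
  qed
  then obtain ys where ys: "distinct ys" "set ys = set xs" "length ys = length xs"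
    "cycle_edges ys = cycle_edges xs" "{u, v} = {hd ys, last ys}" by blast
  then have "ys \<noteq> []" using assms by auto
  from ys(5) consider "u = hd ys" "v = last ys" | "u = last ys" "v = hd ys"
    by (auto simp: doubleton_eq_iff)
  then show ?thesis
  proof cases
    case 1
    then show ?thesis using ys by blast
  next
    case 2
    then show ?thesis using ys \<open>ys \<noteq> []\<close>
      by (intro exI[of _ "rev ys"]) (simp add: cycle_edges_rev hd_rev last_rev)
  qed
qed

text \<open>Cut at the two marked edges, the cycles become paths from \<open>u\<close> to
  \<open>u'\<close> and from \<open>v'\<close> to \<open>v\<close>; concatenated, they are joined by
  \<open>{u', v'}\<close> and closed by \<open>{v, u}\<close>. Every other marked edge survives, so
  the result can be glued again.\<close>

lemma cyclic_glue:
  assumes "cyclic E V M" "cyclic E W M'" "V \<inter> W = {}"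
    and "{u, u'} \<in> M" "{v, v'} \<in> M'" "{u, v} \<in> E" "{u', v'} \<in> E"
  shows "cyclic E (V \<union> W) ((M - {{u, u'}}) \<union> (M' - {{v, v'}}))"
proof -
  obtain xs where xs: "distinct xs" "set xs = V" "3 \<le> length xs" "cycle_edges xs \<subseteq> E" "M \<subseteq> cycle_edges xs"
    using assms(1) unfolding cyclic_def by blast
  obtain ys where ys: "distinct ys" "set ys = W" "3 \<le> length ys" "cycle_edges ys \<subseteq> E" "M' \<subseteq> cycle_edges ys"
    using assms(2) unfolding cyclic_def by blast
  obtain as where as: "distinct as" "set as = V" "length as = length xs" "cycle_edges as = cycle_edges xs"
    "hd as = u" "last as = u'"
    using cycle_open_at_edge[of u u' xs] xs assms(4) by fastforce
  obtain bs where bs: "distinct bs" "set bs = W" "length bs = length ys" "cycle_edges bs = cycle_edges ys"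
    "hd bs = v'" "last bs = v"
    using cycle_open_at_edge[of v' v ys] ys assms(5) by (fastforce simp: insert_commute)
  have ne: "as \<noteq> []" "bs \<noteq> []" using as bs xs ys by auto
  have ce: "cycle_edges (as @ bs) = insert {v, u} (insert {u', v'} (path_edges as \<union> path_edges bs))"
    using ne as bs by (simp add: cycle_edges_def path_edges_append)
  have "M - {{u, u'}} \<subseteq> path_edges as"
    using xs(5) as(4-6) unfolding cycle_edges_def[of as] by (auto simp: insert_commute)
  moreover have "M' - {{v, v'}} \<subseteq> path_edges bs"
    using ys(5) bs(4-6) unfolding cycle_edges_def[of bs] by (auto simp: insert_commute)
  moreover have "path_edges as \<subseteq> E" "path_edges bs \<subseteq> E"
    using xs(4) ys(4) unfolding as(4)[symmetric] bs(4)[symmetric] by (simp_all add: cycle_edges_def)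
  ultimately have "cycle_edges (as @ bs) \<subseteq> E"
    "(M - {{u, u'}}) \<union> (M' - {{v, v'}}) \<subseteq> cycle_edges (as @ bs)"
    unfolding ce using assms(6,7) by (auto simp: insert_commute)
  moreover have "distinct (as @ bs)" "set (as @ bs) = V \<union> W" "3 \<le> length (as @ bs)"
    using as(1-3) bs(1,2) xs(3) assms(3) by auto
  ultimately show ?thesis unfolding cyclic_def by blast
qed

lemma cycle_edges_subset: "xs \<noteq> [] \<Longrightarrow> cycle_edges xs \<subseteq> Pow (set xs)"
proof -
  have "path_edges xs \<subseteq> Pow (set xs)"
    by (induction xs rule: path_edges.induct) auto
  then show "xs \<noteq> [] \<Longrightarrow> ?thesis" by (simp add: cycle_edges_def)
qed

lemma cyclic_subset:
  assumes "cyclic E V M"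
  shows "M \<subseteq> Pow V"
proof -
  obtain xs where "set xs = V" "3 \<le> length xs" "M \<subseteq> cycle_edges xs"
    using assms unfolding cyclic_def by blast
  moreover from this have "xs \<noteq> []" by auto
  ultimately show ?thesis using cycle_edges_subset[of xs] by blast
qed

lemma cyclic_mono: "\<lbrakk>cyclic E V M; M' \<subseteq> M\<rbrakk> \<Longrightarrow> cyclic E V M'"
  unfolding cyclic_def by blast

lemma path_edges_map: "path_edges (map f xs) = image f ` path_edges xs"
  by (induction xs rule: path_edges.induct) auto

lemma cycle_edges_map: "xs \<noteq> [] \<Longrightarrow> cycle_edges (map f xs) = image f ` cycle_edges xs"
  by (simp add: cycle_edges_def path_edges_map hd_map last_map)

lemma cyclic_image:
  assumes "cyclic E V M" "inj_on f V" "\<And>e. \<lbrakk>e \<in> E; e \<subseteq> V\<rbrakk> \<Longrightarrow> f ` e \<in> E'"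
  shows "cyclic E' (f ` V) (image f ` M)"
proof -
  obtain xs where xs: "distinct xs" "set xs = V" "3 \<le> length xs" "cycle_edges xs \<subseteq> E" "M \<subseteq> cycle_edges xs"
    using assms(1) unfolding cyclic_def by blast
  have ne: "xs \<noteq> []" using xs(3) by auto
  then have "cycle_edges xs \<subseteq> Pow V"
    using cycle_edges_subset[of xs] xs(2) by simp
  then have "cycle_edges (map f xs) \<subseteq> E'"
    unfolding cycle_edges_map[OF ne] using xs(4) assms(3) by blast
  moreover have "image f ` M \<subseteq> cycle_edges (map f xs)"
    unfolding cycle_edges_map[OF ne] using xs(5) by blast
  ultimately show ?thesis
    unfolding cyclic_def using xs assms(2)
    by (intro exI[of _ "map f xs"]) (simp add: distinct_map)
qed

text \<open>Star-shaped gluing around one central cycle: the central edges are pairwise distinct, so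
  no attachment spends the edge of another one.\<close>

lemma cyclic_attach:
  assumes "finite I" "cyclic E V M" "\<And>i. i \<in> I \<Longrightarrow> cyclic E (B i) (K i)"
    and "\<And>i. i \<in> I \<Longrightarrow> V \<inter> B i = {}" "\<And>i j. \<lbrakk>i \<in> I; j \<in> I; i \<noteq> j\<rbrakk> \<Longrightarrow> B i \<inter> B j = {}"
    and "\<And>i. i \<in> I \<Longrightarrow> {a i, a' i} \<in> K i" "\<And>i. i \<in> I \<Longrightarrow> {d i, d' i} \<in> M"
    and "\<And>i. i \<in> I \<Longrightarrow> {d i, a i} \<in> E" "\<And>i. i \<in> I \<Longrightarrow> {d' i, a' i} \<in> E"
    and "\<And>i j. \<lbrakk>i \<in> I; j \<in> I; {d i, d' i} = {d j, d' j}\<rbrakk> \<Longrightarrow> i = j"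
  shows "cyclic E (V \<union> (\<Union>i\<in>I. B i))
    ((M - (\<lambda>i. {d i, d' i}) ` I) \<union> (\<Union>i\<in>I. K i - {{a i, a' i}}))"
  using assms
proof (induction I rule: finite_induct)
  case empty
  then show ?case by simp
next
  case (insert i I)
  let ?V = "V \<union> (\<Union>i\<in>I. B i)"
  let ?M = "(M - (\<lambda>i. {d i, d' i}) ` I) \<union> (\<Union>i\<in>I. K i - {{a i, a' i}})"
  have IH: "cyclic E ?V ?M"
    by (intro insert.IH insert.prems insertI2)
  have "{d i, d' i} \<notin> (\<lambda>i. {d i, d' i}) ` I"
    using insert.prems(9) insert.hyps(2) by blast
  then have "{d i, d' i} \<in> ?M" using insert.prems(6) by blast
  moreover have "?V \<inter> B i = {}" using insert.prems(3,4) insert.hyps(2) by blast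
  ultimately have "cyclic E (?V \<union> B i) ((?M - {{d i, d' i}}) \<union> (K i - {{a i, a' i}}))"
    by (intro cyclic_glue[OF IH] insert.prems insertI1)
  moreover have "?V \<union> B i = V \<union> (\<Union>i\<in>insert i I. B i)" by blast
  \<comment> \<open>The edges of \<open>K j\<close> lie in \<open>B j\<close>, which is disjoint
    from \<open>V\<close>; discarding a central edge therefore removes none of them.\<close>
  moreover have "K j \<inter> {{d i, d' i}} = {}" if j: "j \<in> I" for j
  proof -
    have "{d i, d' i} \<subseteq> V"
      using insert.prems(6)[of i] cyclic_subset[OF insert.prems(1)] by blast
    moreover have "K j \<subseteq> Pow (B j)" using cyclic_subset[OF insert.prems(2)] j by blast
    moreover have "V \<inter> B j = {}" using insert.prems(3) j by blast
    ultimately show ?thesis by blast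
  qed
  then have "(M - (\<lambda>i. {d i, d' i}) ` insert i I) \<union> (\<Union>i\<in>insert i I. K i - {{a i, a' i}})
    \<subseteq> (?M - {{d i, d' i}}) \<union> (K i - {{a i, a' i}})" by blast
  ultimately show ?case by (simp only: cyclic_mono)
qed

text \<open>The rung over \<open>h\<close> is still on the cycle as long as no neighbor of \<open>h\<close>
  lies in a part that has been glued.\<close>

lemma cyclic_glue_rungs:
  fixes vx :: "bool \<Rightarrow> 'h \<Rightarrow> 'v" and part :: "'h \<Rightarrow> 'i"
  defines "B i \<equiv> {vx s h | s h. part h = i}" and "rung h \<equiv> {vx True h, vx False h}"
  assumes fin: "finite I" and r: "r \<in> I"
    and inj: "\<And>s h s' h'. vx s h = vx s' h' \<Longrightarrow> s = s' \<and> h = h'"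
    and sym: "\<And>h h'. lk h h' \<Longrightarrow> lk h' h"
    and E: "\<And>s h h'. lk h h' \<Longrightarrow> {vx s h, vx s h'} \<in> E"
    and cyc: "\<And>i. i \<in> I \<Longrightarrow> cyclic E (B i) (rung ` {h. part h = i} \<union> K i)"
    and K: "\<And>i h. rung h \<notin> K i"
    and step: "\<And>i j. step i j \<Longrightarrow> \<exists>h h'. part h = i \<and> part h' = j \<and> lk h h' \<and> (\<forall>h''. lk h h'' \<longrightarrow> h'' = h')"
    and reach: "\<And>i. i \<in> I \<Longrightarrow> step\<^sup>*\<^sup>* r i"
    and closed: "\<And>i j. \<lbrakk>i \<in> I; step i j\<rbrakk> \<Longrightarrow> j \<in> I"
  shows "cyclic E (\<Union>i\<in>I. B i) (\<Union>i\<in>I. K i)"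
proof -
  define free where "free S = {rung h | h. part h \<in> S \<and> (\<forall>h'. lk h h' \<longrightarrow> part h' \<notin> S)}" for S
  have rung_inj: "h = h'" if "rung h = rung h'" for h h'
    using that inj unfolding rung_def doubleton_eq_iff by blast
  have grow: "\<exists>S \<subseteq> I. r \<in> S \<and> card S = Suc k \<and> cyclic E (\<Union>i\<in>S. B i) (free S \<union> (\<Union>i\<in>S. K i))"
    if "k < card I" for k
    using that
  proof (induction k)
    case 0
    have "free {r} \<subseteq> rung ` {h. part h = r}" unfolding free_def by blast
    then have "cyclic E (B r) (free {r} \<union> K r)"
      by (intro cyclic_mono[OF cyc[OF r]]) blast
    then show ?case using r by (intro exI[of _ "{r}"]) simp
  next
    case (Suc k)
    then obtain S where S: "S \<subseteq> I" "r \<in> S" "card S = Suc k"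
      and cS: "cyclic E (\<Union>i\<in>S. B i) (free S \<union> (\<Union>i\<in>S. K i))" by auto
    have "\<not> I \<subseteq> S" using S Suc.prems card_mono[OF finite_subset[OF S(1) fin], of I] by auto
    then obtain t where t: "t \<in> I" "t \<notin> S" by blast
    \<comment> \<open>Since all of \<open>I\<close> is reachable from \<open>r\<close>, some step
      leaves the proper subset \<open>S\<close>.\<close>
    have "\<exists>i j. i \<in> S \<and> j \<notin> S \<and> step i j"
    proof (rule ccontr)
      assume n: "\<not> ?thesis"
      have "y \<in> S" if "step\<^sup>*\<^sup>* r y" for y
        using that by (induction rule: rtranclp_induct) (use S n in blast)+
      then show False using reach t by blast
    qed
    then obtain i j where ij: "i \<in> S" "j \<notin> S" "step i j" by blast
    then have jI: "j \<in> I" using closed S by blast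
    obtain h h' where h: "part h = i" "part h' = j" "lk h h'" "\<And>h''. lk h h'' \<Longrightarrow> h'' = h'"
      using step[OF ij(3)] by blast
    have disj: "(\<Union>i\<in>S. B i) \<inter> B j = {}" using ij(2) inj unfolding B_def by blast
    \<comment> \<open>The only neighbor of \<open>h\<close> is \<open>h'\<close>, whose part
      \<open>j\<close> is still missing, so no earlier merge can have spent this rung.\<close>
    have rS: "rung h \<in> free S \<union> (\<Union>i\<in>S. K i)"
      unfolding free_def using h ij by blast
    have rj: "rung h' \<in> rung ` {h. part h = j} \<union> K j" using h by blast
    note glue = cyclic_glue[OF cS cyc[OF jI] disj, of "vx True h" "vx False h" "vx True h'" "vx False h'"]
    have "cyclic E ((\<Union>i\<in>S. B i) \<union> B j)
      (((free S \<union> (\<Union>i\<in>S. K i)) - {rung h}) \<union> ((rung ` {h. part h = j} \<union> K j) - {rung h'}))"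
      using glue[OF rS[unfolded rung_def[of h]] rj[unfolded rung_def[of h']] E[OF h(3)] E[OF h(3)]]
      unfolding rung_def[of h] rung_def[of h'] .
    moreover have "free (insert j S) \<subseteq> (free S \<union> rung ` {h. part h = j}) - {rung h, rung h'}"
    proof
      fix e assume "e \<in> free (insert j S)"
      then obtain g where g: "e = rung g" "part g \<in> insert j S" "\<And>g'. lk g g' \<Longrightarrow> part g' \<notin> insert j S"
        unfolding free_def by blast
      \<comment> \<open>The two spent rungs are not claimed any more: \<open>h\<close> and
        \<open>h'\<close> are neighbors whose parts now both belong to the glued set.\<close>
      have "g \<noteq> h" "g \<noteq> h'" using g(3) h ij sym[OF h(3)] by blast+
      then show "e \<in> (free S \<union> rung ` {h. part h = j}) - {rung h, rung h'}"
        using g rung_inj unfolding free_def by blast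
    qed
    moreover have "\<And>i h. rung h \<notin> K i" by (rule K)
    ultimately have "cyclic E ((\<Union>i\<in>S. B i) \<union> B j) (free (insert j S) \<union> (\<Union>i\<in>insert j S. K i))"
      by (elim cyclic_mono) blast
    moreover have "(\<Union>i\<in>S. B i) \<union> B j = (\<Union>i\<in>insert j S. B i)" by blast
    moreover have "card (insert j S) = Suc (Suc k)"
      using S ij fin by (simp add: finite_subset)
    ultimately show ?case using S jI by (intro exI[of _ "insert j S"]) auto
  qed
  have "0 < card I" using r fin card_gt_0_iff by blast
  then obtain S where S: "S \<subseteq> I" "card S = card I"
    and c: "cyclic E (\<Union>i\<in>S. B i) (free S \<union> (\<Union>i\<in>S. K i))"
    using grow[of "card I - 1"] by auto
  have "S = I" using S fin by (simp add: card_subset_eq)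
  then show ?thesis by (intro cyclic_mono[OF c[unfolded \<open>S = I\<close>]]) blast
qed

section \<open>Decorated ternary trees\<close>

text \<open>A node \<open>SN x y z\<close> is a quadrangle with the subtrees beyond its three sides other than its root
  side; the Boolean of \<open>DN\<close> selects its monochromatic diagonal. \<open>SU x\<close> is the triangle at the
  monochromatic side of a polygon with an odd number of points. As this side is next to the root
  side, that triangle is reached by following first children only; the flag of \<open>wf_shp\<close> says whether it
  is present.\<close>

datatype shp = SL | SU shp | SN shp shp shp

datatype dt = DL | DU dt | DN bool dt dt dt

fun shape :: "dt \<Rightarrow> shp" where
  "shape DL = SL"
| "shape (DU x) = SU (shape x)"
| "shape (DN s x y z) = SN (shape x) (shape y) (shape z)"

fun quads :: "shp \<Rightarrow> nat" where
  "quads SL = 0"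
| "quads (SU x) = quads x"
| "quads (SN x y z) = Suc (quads x + quads y + quads z)"

fun wf_shp :: "bool \<Rightarrow> shp \<Rightarrow> bool" where
  "wf_shp d SL \<longleftrightarrow> \<not> d"
| "wf_shp d (SU x) \<longleftrightarrow> d \<and> wf_shp False x"
| "wf_shp d (SN x y z) \<longleftrightarrow> wf_shp d x \<and> wf_shp False y \<and> wf_shp False z"

inductive toggle :: "dt \<Rightarrow> dt \<Rightarrow> bool" where
  toggle_root: "toggle (DN s x y z) (DN (\<not> s) x y z)"
| toggle_1: "toggle x x' \<Longrightarrow> toggle (DN s x y z) (DN s x' y z)"
| toggle_2: "toggle y y' \<Longrightarrow> toggle (DN s x y z) (DN s x y' z)"
| toggle_3: "toggle z z' \<Longrightarrow> toggle (DN s x y z) (DN s x y z')"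
| toggle_U: "toggle x x' \<Longrightarrow> toggle (DU x) (DU x')"

text \<open>Two adjacent quadrangles form a hexagon, and \<open>move_ij\<close> takes the lower one
  from side \<open>i\<close> to side \<open>j\<close> of the upper one. The second side starts at a
  point of the other color than the root side, so different colors of the diagonals mean equal
  Booleans there, and different Booleans at the first and third side. In \<open>move_UN\<close> and
  \<open>move_NU\<close> the triangle at the monochromatic side acts like a quadrangle in state
  \<open>True\<close>.\<close>

inductive move :: "dt \<Rightarrow> dt \<Rightarrow> bool" where
  move_12: "move (DN True (DN False a b c) d e) (DN True a (DN True b c d) e)"
| move_21: "move (DN True a (DN True b c d) e) (DN True (DN False a b c) d e)"
| move_23: "move (DN False a (DN False b c d) e) (DN False a b (DN True c d e))"
| move_32: "move (DN False a b (DN True c d e)) (DN False a (DN False b c d) e)"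
| move_13: "move (DN False (DN True a b c) d e) (DN True a b (DN False c d e))"
| move_31: "move (DN True a b (DN False c d e)) (DN False (DN True a b c) d e)"
| move_UN: "move (DU (DN False a b c)) (DN False (DU a) b c)"
| move_NU: "move (DN False (DU a) b c) (DU (DN False a b c))"
| move_1: "move x x' \<Longrightarrow> move (DN s x y z) (DN s x' y z)"
| move_2: "move y y' \<Longrightarrow> move (DN s x y z) (DN s x y' z)"
| move_3: "move z z' \<Longrightarrow> move (DN s x y z) (DN s x y z')"
| move_U: "move x x' \<Longrightarrow> move (DU x) (DU x')"

inductive_cases move_DLE: "move DL w"
inductive_cases move_DUE: "move (DU x) w"
inductive_cases move_DNE: "move (DN s x y z) w"

lemma move_sym: "move w w' \<Longrightarrow> move w' w"
  by (induction rule: move.induct) (auto intro: move.intros)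

text \<open>All diagonals that have been chosen inside the quadrangles get the same color; then no
  diagonal between two quadrangles can be flipped.\<close>

fun frozen :: "bool \<Rightarrow> shp \<Rightarrow> dt" where
  "frozen s SL = DL"
| "frozen s (SU x) = DU (frozen s x)"
| "frozen s (SN x y z) = DN s (frozen s x) (frozen (\<not> s) y) (frozen s z)"

lemma shape_frozen [simp]: "shape (frozen s t) = t"
  by (induction t arbitrary: s) auto

lemma frozen_eq_DN: "frozen s t = DN s' x y z \<Longrightarrow> s' = s"
  by (cases t) auto

lemma frozen_eq_DU: "frozen s t = DU x \<Longrightarrow> \<exists>t'. t = SU t' \<and> x = frozen s t'"
  by (cases t) auto

text \<open>The triangle at the monochromatic side can be flipped with any adjacent quadrangle in
  state \<open>False\<close>. A tree that contains it can thus be frozen only in the color of that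
  side, whence \<open>d \<longrightarrow> s\<close>.\<close>

lemma not_move_frozen: "\<lbrakk>wf_shp d t; d \<longrightarrow> s\<rbrakk> \<Longrightarrow> \<not> move (frozen s t) w"
proof (induction t arbitrary: d s w)
  case SL
  then show ?case by (auto elim: move_DLE)
next
  case (SU t)
  then have "d" "s" "wf_shp False t" by auto
  then show ?case using SU.IH[of False s] by (auto elim!: move_DUE dest: frozen_eq_DN)
next
  case (SN x y z)
  have IH: "\<not> move (frozen s x) w" "\<not> move (frozen (\<not> s) y) w" "\<not> move (frozen s z) w" for w
    using SN.IH(1)[of d s] SN.IH(2)[of False "\<not> s"] SN.IH(3)[of False s] SN.prems by auto
  have SU: "d" if "frozen s x = DU x'" for x'
    using frozen_eq_DU[OF that] SN.prems(1) by auto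
  show ?case
  proof
    assume "move (frozen s (SN x y z)) w"
    then show False using SN.prems(2) IH SU
      by (auto elim!: move_DNE dest: frozen_eq_DN)
  qed
qed

text \<open>Each of these changes of the dissection is the only move of some decorated tree; they are not
  symmetric, since for odd \<open>N\<close> a decoration with no other move exists only in one direction.\<close>

inductive step :: "shp \<Rightarrow> shp \<Rightarrow> bool" where
  step_31: "step (SN p q (SN r y z)) (SN (SN p q r) y z)"
| step_12: "step (SN (SN SL q r) y z) (SN SL (SN q r y) z)"
| step_3: "step z z' \<Longrightarrow> step (SN SL SL z) (SN SL SL z')"
| step_UN: "step (SU (SN x y z)) (SN (SU x) y z)"
| step_U: "step x x' \<Longrightarrow> step (SU x) (SU x')"

lemma step_size: "step t t' \<Longrightarrow> quads t' = quads t"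
  by (induction rule: step.induct) auto

lemma step_wf: "step t t' \<Longrightarrow> wf_shp d t \<Longrightarrow> wf_shp d t'"
  by (induction arbitrary: d rule: step.induct) auto

text \<open>Strengthens the induction of \<open>step_unique_move\<close>: a subtree with root state
  \<open>True\<close> cannot be flipped against a parent in state \<open>True\<close> at its third
  side, nor against the triangle at the monochromatic side, so its unique move stays unique one
  level higher.\<close>

fun root_state :: "dt \<Rightarrow> bool" where
  "root_state (DN s x y z) = s"
| "root_state _ = True"

lemma unique_moveI:
  "\<lbrakk>shape w = t; shape w' = t'; move w w'; \<And>v. move w v \<Longrightarrow> v = w'; root_state w\<rbrakk> \<Longrightarrow>
    \<exists>w w'. shape w = t \<and> shape w' = t' \<and> move w w' \<and> (\<forall>w''. move w w'' \<longrightarrow> w'' = w') \<and> root_state w"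
  by blast

lemma step_unique_move:
  assumes "step t t'" "wf_shp d t"
  shows "\<exists>w w'. shape w = t \<and> shape w' = t' \<and> move w w' \<and> (\<forall>w''. move w w'' \<longrightarrow> w'' = w') \<and> root_state w"
  using assms
proof (induction arbitrary: d rule: step.induct)
  case (step_31 p q r y z)
  \<comment> \<open>The third subtree gets one color and everything else the other;
    \<open>frozen False q\<close> belongs to the latter, as the second child starts at a point of
    opposite color. A triangle at the monochromatic side can only be in \<open>p\<close>, where the
    state is \<open>True\<close> as required.\<close>
  let ?w = "DN True (frozen True p) (frozen False q) (frozen False (SN r y z))"
  let ?w' = "DN False (DN True (frozen True p) (frozen False q) (frozen False r)) (frozen True y) (frozen False z)"
  have nm: "\<not> move (frozen True p) v" "\<not> move (frozen False q) v" "\<not> move (frozen False (SN r y z)) v" for v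
    using step_31 not_move_frozen[of d p True v] not_move_frozen[of False q False v]
      not_move_frozen[of False "SN r y z" False v] by (simp_all del: frozen.simps)
  have mv: "move ?w ?w'" using move_31 by simp
  have un: "v = ?w'" if "move ?w v" for v
    using that by (rule move_DNE) (use nm in \<open>auto dest: frozen_eq_DN\<close>)
  show ?case by (rule unique_moveI[OF _ _ mv un]) simp_all
next
  case (step_12 q r y z)
  \<comment> \<open>Now the first subtree has to be in state \<open>False\<close>, where a triangle
    at the monochromatic side would allow another move. The leaf in \<open>step_12\<close> keeps
    that triangle away.\<close>
  let ?w = "DN True (frozen False (SN SL q r)) (frozen False y) (frozen True z)"
  let ?w' = "DN True DL (DN True (frozen True q) (frozen False r) (frozen False y)) (frozen True z)"
  have nm: "\<not> move (frozen False (SN SL q r)) v" "\<not> move (frozen False y) v" "\<not> move (frozen True z) v" for v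
    using step_12 not_move_frozen[of False "SN SL q r" False v] not_move_frozen[of False y False v]
      not_move_frozen[of False z True v] by (simp_all del: frozen.simps)
  have mv: "move ?w ?w'" using move_12 by simp
  have un: "v = ?w'" if "move ?w v" for v
    using that by (rule move_DNE) (use nm in \<open>auto dest: frozen_eq_DN\<close>)
  show ?case by (rule unique_moveI[OF _ _ mv un]) simp_all
next
  case (step_3 z z')
  then have "wf_shp False z" by simp
  then obtain w w' where w: "shape w = z" "shape w' = z'" "move w w'" "\<And>v. move w v \<Longrightarrow> v = w'" "root_state w"
    using step_3.IH by blast
  have un: "v = DN True DL DL w'" if "move (DN True DL DL w) v" for v
    using that by (rule move_DNE) (use w(4,5) in \<open>auto elim: move_DLE\<close>)
  show ?case by (rule unique_moveI[OF _ _ move.move_3[OF w(3)] un]) (simp_all add: w)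
next
  case (step_UN x y z)
  let ?w = "DU (frozen False (SN x y z))"
  let ?w' = "DN False (DU (frozen False x)) (frozen True y) (frozen False z)"
  have nm: "\<not> move (frozen False (SN x y z)) v" for v
    using step_UN not_move_frozen[of False "SN x y z" False v] by (simp del: frozen.simps)
  have mv: "move ?w ?w'" using move_UN by simp
  have un: "v = ?w'" if "move ?w v" for v
    using that by (rule move_DUE) (use nm in auto)
  show ?case by (rule unique_moveI[OF _ _ mv un]) simp_all
next
  case (step_U x x')
  then have "wf_shp False x" by simp
  then obtain w w' where w: "shape w = x" "shape w' = x'" "move w w'" "\<And>v. move w v \<Longrightarrow> v = w'" "root_state w"
    using step_U.IH by blast
  have un: "v = DU w'" if "move (DU w) v" for v
    using that by (rule move_DUE) (use w(4,5) in auto)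
  show ?case by (rule unique_moveI[OF _ _ move.move_U[OF w(3)] un]) (simp_all add: w)
qed

section \<open>All dissections are reachable from a comb\<close>

fun comb :: "nat \<Rightarrow> shp" where
  "comb 0 = SL"
| "comb (Suc n) = SN SL SL (comb n)"

lemma size_comb [simp]: "quads (comb n) = n"
  by (induction n) auto

lemma wf_comb [simp]: "wf_shp False (comb n)"
  by (induction n) auto

lemma comb_eq_iff [simp]: "comb m = comb n \<longleftrightarrow> m = n"
  by (metis size_comb)

lemma reach_3: "step\<^sup>*\<^sup>* z z' \<Longrightarrow> step\<^sup>*\<^sup>* (SN SL SL z) (SN SL SL z')"
  by (induction rule: rtranclp_induct) (auto intro: step.step_3 rtranclp.rtrancl_into_rtrancl)

lemma reach_U: "step\<^sup>*\<^sup>* x x' \<Longrightarrow> step\<^sup>*\<^sup>* (SU x) (SU x')"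
  by (induction rule: rtranclp_induct) (auto intro: step.step_U rtranclp.rtrancl_into_rtrancl)

fun fst_size snd_size :: "shp \<Rightarrow> nat" where
  "fst_size (SN x y z) = quads x"
| "fst_size _ = 0"
| "snd_size (SN x y z) = quads y"
| "snd_size _ = 0"

text \<open>Steps are undone until only the comb is left. Undoing \<open>step_31\<close> shrinks the
  first child; once it is empty, undoing \<open>step_12\<close> and then \<open>step_31\<close>
  shrinks the second child; once both are empty, the third child is treated recursively. The measure
  orders these three kinds of progress lexicographically.\<close>

lemma reach_comb: "wf_shp False t \<Longrightarrow> step\<^sup>*\<^sup>* (comb (quads t)) t"
proof (induction t rule: wf_induct[of "measures [quads, fst_size, snd_size]", case_names wf less])
  case wf
  then show ?case by simp
next
  case (less t)
  show ?case
  proof (cases t)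
    case (SN x y z)
    show ?thesis
    proof (cases x)
      case x: (SN p q r)
      have "step\<^sup>*\<^sup>* (comb (quads t)) (SN p q (SN r y z))"
        using less.IH[rule_format, of "SN p q (SN r y z)"] less.prems SN x by (simp add: ac_simps)
      then show ?thesis unfolding SN x by (rule rtranclp.rtrancl_into_rtrancl) (rule step_31)
    next
      case x: SL
      show ?thesis
      proof (cases y)
        case y: (SN p q r)
        have "step\<^sup>*\<^sup>* (comb (quads t)) (SN SL p (SN q r z))"
          using less.IH[rule_format, of "SN SL p (SN q r z)"] less.prems SN x y by (simp add: ac_simps)
        then have "step\<^sup>*\<^sup>* (comb (quads t)) (SN (SN SL p q) r z)"
          by (rule rtranclp.rtrancl_into_rtrancl) (rule step_31)
        then show ?thesis unfolding SN x y by (rule rtranclp.rtrancl_into_rtrancl) (rule step_12)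
      next
        case y: SL
        have "step\<^sup>*\<^sup>* (comb (quads z)) z"
          using less.IH[rule_format, of z] less.prems SN x y by simp
        then show ?thesis unfolding SN x y using reach_3 by simp
      qed (use less.prems SN in simp)
    qed (use less.prems SN in simp)
  qed (use less.prems in auto)
qed

text \<open>Undoing \<open>step_31\<close> shortens the first child until it is the triangle at the
  monochromatic side; undoing \<open>step_UN\<close> then pulls that triangle up to the root, and
  below it \<open>reach_comb\<close> applies.\<close>

lemma reach_U_comb: "wf_shp True t \<Longrightarrow> step\<^sup>*\<^sup>* (SU (comb (quads t))) t"
proof (induction "fst_size t" arbitrary: t rule: less_induct)
  case less
  show ?case
  proof (cases t)
    case (SU x)
    then show ?thesis using reach_U[OF reach_comb[of x]] less.prems by simp
  next
    case (SN x y z)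
    show ?thesis
    proof (cases x)
      case x: (SU x')
      have "step\<^sup>*\<^sup>* (SU (comb (quads t))) (SU (SN x' y z))"
        using reach_U[OF reach_comb[of "SN x' y z"]] less.prems SN x by simp
      then show ?thesis unfolding SN x by (rule rtranclp.rtrancl_into_rtrancl) (rule step_UN)
    next
      case x: (SN p q r)
      have "step\<^sup>*\<^sup>* (SU (comb (quads t))) (SN p q (SN r y z))"
        using less.hyps[of "SN p q (SN r y z)"] less.prems SN x by (simp add: ac_simps)
      then show ?thesis unfolding SN x by (rule rtranclp.rtrancl_into_rtrancl) (rule step_31)
    qed (use less.prems SN in simp)
  qed (use less.prems in simp)
qed

definition shps :: "bool \<Rightarrow> nat \<Rightarrow> shp set" where
  "shps d n = {t. wf_shp d t \<and> quads t = n}"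

definition base_shp :: "bool \<Rightarrow> nat \<Rightarrow> shp" where
  "base_shp d n = (if d then SU (comb n) else comb n)"

lemma base_shp_in: "base_shp d n \<in> shps d n"
  by (auto simp: base_shp_def shps_def)

lemma reach_base: "t \<in> shps d n \<Longrightarrow> step\<^sup>*\<^sup>* (base_shp d n) t"
  using reach_comb reach_U_comb by (auto simp: base_shp_def shps_def)

lemma finite_shps: "finite (shps d n)"
proof -
  have 1: "finite {t. wf_shp False t \<and> quads t < n}" (is "finite (?A n)") for n
  proof (induction n)
    case (Suc n)
    have "?A (Suc n) \<subseteq> insert SL ((\<lambda>(x, y, z). SN x y z) ` (?A n \<times> ?A n \<times> ?A n))"
    proof
      fix t assume "t \<in> ?A (Suc n)"
      then show "t \<in> insert SL ((\<lambda>(x, y, z). SN x y z) ` (?A n \<times> ?A n \<times> ?A n))"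
        by (cases t) (auto simp: image_iff)
    qed
    then show ?case using Suc by (meson finite_SigmaI finite_imageI finite_insert finite_subset)
  qed simp
  have 2: "finite {t. wf_shp True t \<and> quads t < n}" (is "finite (?B n)") for n
  proof (induction n)
    case (Suc n)
    have "?B (Suc n) \<subseteq> SU ` ?A (Suc n) \<union> (\<lambda>(x, y, z). SN x y z) ` (?B n \<times> ?A n \<times> ?A n)"
    proof
      fix t assume "t \<in> ?B (Suc n)"
      then show "t \<in> SU ` ?A (Suc n) \<union> (\<lambda>(x, y, z). SN x y z) ` (?B n \<times> ?A n \<times> ?A n)"
        by (cases t) (auto simp: image_iff)
    qed
    then show ?case using Suc 1 by (meson finite_SigmaI finite_imageI finite_UnI finite_subset)
  qed simp
  have "shps d n \<subseteq> ?A (Suc n) \<union> ?B (Suc n)"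
    unfolding shps_def by (cases d) auto
  then show ?thesis using 1 2 by (meson finite_UnI finite_subset)
qed

section \<open>Cycles in blocks\<close>

fun differ1 :: "bool list \<Rightarrow> bool list \<Rightarrow> bool" where
  "differ1 (x # xs) (y # ys) \<longleftrightarrow> x \<noteq> y \<and> xs = ys \<or> x = y \<and> differ1 xs ys"
| "differ1 _ _ \<longleftrightarrow> False"

lemma differ1_sym: "differ1 xs ys \<Longrightarrow> differ1 ys xs"
  by (induction xs ys rule: differ1.induct) auto

lemma differ1_append:
  "length xs = length xs' \<Longrightarrow>
    differ1 (xs @ ys) (xs' @ ys') \<longleftrightarrow> differ1 xs xs' \<and> ys = ys' \<or> xs = xs' \<and> differ1 ys ys'"
  by (induction xs xs' rule: list_induct2) auto

text \<open>The even length is recorded because \<open>zigzag\<close> consumes the points in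
  pairs.\<close>

definition ham_path :: "nat \<Rightarrow> bool list list \<Rightarrow> bool" where
  "ham_path n ps \<longleftrightarrow> distinct ps \<and> set ps = {bs. length bs = n} \<and> successively differ1 ps \<and>
     even (length ps) \<and> ps \<noteq> []"

lemma Cons_image: "(#) x ` {bs. length bs = n} \<union> (#) (\<not> x) ` {bs. length bs = n} = {bs. length bs = Suc n}"
proof -
  have "bs \<in> (#) x ` {bs. length bs = n} \<union> (#) (\<not> x) ` {bs. length bs = n}" if "length bs = Suc n" for bs
    using that by (cases bs; cases "hd bs = x") auto
  then show ?thesis by auto
qed

lemma successively_map_Cons: "successively differ1 ps \<Longrightarrow> successively differ1 (map ((#) x) ps)"
  by (induction ps rule: induct_list012) auto

lemma successively_differ1_rev: "successively differ1 (rev ps) \<longleftrightarrow> successively differ1 ps"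
  using differ1_sym by (auto simp: successively_rev elim: successively_mono)

text \<open>Induction on the first bit. If the ends differ there, one half is traversed up to a
  neighbor of the start, and the mirrored path leads back through the other half. If they agree, the
  first edge of a path in their half is replaced by a detour through the whole other half.\<close>

lemma ham_path_exists:
  "\<lbrakk>differ1 b b'; length b = n; length b' = n\<rbrakk> \<Longrightarrow> \<exists>ps. ham_path n ps \<and> hd ps = b \<and> last ps = b'"
proof (induction n arbitrary: b b')
  case 0
  then show ?case by simp
next
  case (Suc n)
  obtain x xs y ys where b: "b = x # xs" "b' = y # ys" "length xs = n" "length ys = n"
    using Suc.prems by (cases b; cases b') auto
  show ?case
  proof (cases "x = y")
    case False
    then have y: "y = (\<not> x)" "ys = xs" using Suc.prems b by auto
    show ?thesis
    proof (cases xs)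
      case Nil
      then show ?thesis using b y
        by (intro exI[of _ "[[x], [\<not> x]]"]) (auto simp: ham_path_def length_Suc_conv)
    next
      case (Cons z zs)
      have "differ1 xs ((\<not> z) # zs)" using Cons by simp
      then obtain ps where ps: "ham_path n ps" "hd ps = xs" "last ps = (\<not> z) # zs"
        using Suc.IH[of xs "(\<not> z) # zs"] b Cons by auto
      have ne: "ps \<noteq> []" using ps by (simp add: ham_path_def)
      let ?r = "map ((#) x) ps @ map ((#) (\<not> x)) (rev ps)"
      have "set ?r = {bs. length bs = Suc n}"
        using ps(1) Cons_image[of x n] by (simp add: ham_path_def)
      moreover have "distinct ?r" using ps(1) by (auto simp: ham_path_def distinct_map)
      moreover have "successively differ1 (map ((#) x) ps)" "successively differ1 (map ((#) (\<not> x)) (rev ps))"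
        using ps(1) by (intro successively_map_Cons; simp add: ham_path_def successively_differ1_rev
          del: successively_rev)+
      moreover from this have "successively differ1 ?r"
        using ne by (subst successively_append_iff) (auto simp: last_map hd_map hd_rev simp del: successively_map)
      moreover have "even (length ?r)" "?r \<noteq> []" using ne by auto
      moreover have "hd ?r = b" "last ?r = b'"
        using ne ps b y by (auto simp: hd_map last_map last_rev)
      ultimately show ?thesis unfolding ham_path_def by blast
    qed
  next
    case True
    then have d: "differ1 xs ys" using Suc.prems b by auto
    then obtain ps where ps: "ham_path n ps" "hd ps = xs" "last ps = ys"
      using Suc.IH b by blast
    have "xs \<noteq> ys" using d by (induction xs ys rule: differ1.induct) auto
    then obtain p rest where rest: "ps = xs # p # rest"
      using ps unfolding ham_path_def by (cases ps; cases "tl ps") auto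
    then have "differ1 xs p" "length p = n" using ps(1) by (auto simp: ham_path_def)
    then obtain qs where qs: "ham_path n qs" "hd qs = xs" "last qs = p"
      using Suc.IH b by blast
    have ne: "qs \<noteq> []" using qs by (simp add: ham_path_def)
    let ?r = "(x # xs) # map ((#) (\<not> x)) qs @ map ((#) x) (p # rest)"
    have "set ?r = (#) x ` set ps \<union> (#) (\<not> x) ` set qs" by (auto simp: rest)
    then have "set ?r = {bs. length bs = Suc n}"
      using ps(1) qs(1) Cons_image[of x n] by (simp add: ham_path_def)
    moreover have "distinct ?r" using ps(1) qs(1) by (auto simp: ham_path_def distinct_map rest)
    moreover have "successively differ1 ?r"
      using ps(1) qs ne successively_map_Cons[of qs] successively_map_Cons[of "p # rest" x]
      by (auto simp: ham_path_def rest successively_append_iff successively_Cons last_map hd_map)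
    moreover have "even (length ?r)" using ps(1) qs(1) by (auto simp: ham_path_def rest)
    moreover have "hd ?r = b" "last ?r = b'"
      using ps b True rest by (auto simp: last_map)
    ultimately show ?thesis unfolding ham_path_def by blast
  qed
qed

text \<open>The new coordinate is crossed at every point of the path, so all rungs are used. After
  an even number of crossings the walk ends in layer \<open>s\<close>, where the edge between the
  ends of the path closes it; this is the prescribed edge.\<close>

fun zigzag :: "bool \<Rightarrow> bool list list \<Rightarrow> bool list list" where
  "zigzag s (a # b # ps) = (s # a) # ((\<not> s) # a) # ((\<not> s) # b) # (s # b) # zigzag s ps"
| "zigzag s _ = []"

definition cube_edges :: "bool list set set" where
  "cube_edges = {{x, y} | x y. differ1 x y}"

lemma cube_edgesI: "differ1 x y \<Longrightarrow> {x, y} \<in> cube_edges"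
  by (auto simp: cube_edges_def)

lemma zigzag_props:
  assumes "even (length ps)" "distinct ps" "successively differ1 ps"
  shows "set (zigzag s ps) = (#) s ` set ps \<union> (#) (\<not> s) ` set ps"
    "distinct (zigzag s ps)" "length (zigzag s ps) = 2 * length ps"
    "path_edges (zigzag s ps) \<subseteq> cube_edges"
    "p \<in> set ps \<Longrightarrow> {s # p, (\<not> s) # p} \<in> path_edges (zigzag s ps)"
    "ps \<noteq> [] \<Longrightarrow> hd (zigzag s ps) = s # hd ps \<and> last (zigzag s ps) = s # last ps"
  using assms
proof (induction s ps rule: zigzag.induct)
  case (1 s a b ps)
  {
    case 1 then show ?case using "1.IH" by (auto simp: successively_Cons)
  next
    case 2 then show ?case using "1.IH"(1,2) by (auto simp: successively_Cons)
  next
    case 3 then show ?case using "1.IH"(3) by (auto simp: successively_Cons)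
  next
    case 4
    then have IH: "path_edges (zigzag s ps) \<subseteq> cube_edges"
      "ps \<noteq> [] \<Longrightarrow> hd (zigzag s ps) = s # hd ps"
      using "1.IH"(4,6) by (auto simp: successively_Cons)
    show ?case
    proof (cases ps)
      case Nil
      then show ?thesis using 4 by (auto intro!: cube_edgesI)
    next
      case (Cons c qs)
      then obtain zs where "zigzag s ps = (s # c) # zs" using IH(2) 4 by (cases qs) auto
      then show ?thesis using 4 IH(1) Cons by (auto intro!: cube_edgesI simp: successively_Cons)
    qed
  next
    case 5
    have sub: "path_edges zs \<subseteq> path_edges (z # zs)" for z and zs :: "bool list list"
      by (cases zs) auto
    have "path_edges (zigzag s ps) \<subseteq> path_edges (zigzag s (a # b # ps))"
      unfolding zigzag.simps using sub by (meson subset_trans)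
    moreover have "{s # a, (\<not> s) # a} \<in> path_edges (zigzag s (a # b # ps))"
      "{s # b, (\<not> s) # b} \<in> path_edges (zigzag s (a # b # ps))" by auto
    moreover have "p \<in> set ps \<Longrightarrow> {s # p, (\<not> s) # p} \<in> path_edges (zigzag s ps)"
      using 5 "1.IH"(5) by (auto simp: successively_Cons)
    moreover have "p = a \<or> p = b \<or> p \<in> set ps" using 5(1) by auto
    ultimately show ?case by blast
  next
    case 6
    show ?case
    proof (cases ps)
      case (Cons c qs)
      then show ?thesis using 6 "1.IH"(6) by (cases qs) (auto simp: successively_Cons)
    qed simp
  }
qed auto

lemma cube_cycle:
  assumes "differ1 b b'" "length b = n" "length b' = n"
  shows "cyclic cube_edges {bs. length bs = Suc n}
    (insert {s # b, s # b'} {{True # c, False # c} | c. length c = n})"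
proof -
  obtain ps where ps: "ham_path n ps" "hd ps = b" "last ps = b'"
    using ham_path_exists assms by blast
  then have p: "even (length ps)" "distinct ps" "successively differ1 ps" "ps \<noteq> []" "set ps = {bs. length bs = n}"
    by (auto simp: ham_path_def)
  note zz = zigzag_props[where s = s, OF p(1-3)]
  have ce: "cycle_edges (zigzag s ps) = insert {s # b, s # b'} (path_edges (zigzag s ps))"
    using zz(6)[OF p(4)] ps by (simp add: cycle_edges_def insert_commute)
  have "2 \<le> length ps" using p(1,4) by (cases ps; cases "tl ps") auto
  then have "3 \<le> length (zigzag s ps)" using zz(3) by simp
  moreover have "{{True # c, False # c} | c. length c = n} \<subseteq> path_edges (zigzag s ps)"
    using zz(5) p(5) by (cases s) (auto simp: insert_commute)
  moreover have "set (zigzag s ps) = {bs. length bs = Suc n}"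
    using zz(1) Cons_image[of s n] p(5) by simp
  moreover have "cycle_edges (zigzag s ps) \<subseteq> cube_edges"
    unfolding ce using zz(4) assms(1) by (auto intro!: cube_edgesI)
  ultimately show ?thesis
    unfolding cyclic_def using zz(2) ce by (intro exI[of _ "zigzag s ps"]) auto
qed

section \<open>The decorations of one dissection as a hypercube\<close>

fun bits :: "dt \<Rightarrow> bool list" where
  "bits DL = []"
| "bits (DU x) = bits x"
| "bits (DN s x y z) = s # bits x @ bits y @ bits z"

lemma length_bits: "length (bits w) = quads (shape w)"
  by (induction w) auto

lemma bits_inj: "\<lbrakk>shape w = shape w'; bits w = bits w'\<rbrakk> \<Longrightarrow> w = w'"
proof (induction w arbitrary: w')
  case DL
  then show ?case by (cases w') auto
next
  case (DU w)
  then show ?case by (cases w') auto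
next
  case (DN s x y z)
  then obtain s' x' y' z' where w': "w' = DN s' x' y' z'" by (cases w') auto
  have sh: "shape x = shape x'" "shape y = shape y'" "shape z = shape z'" using DN.prems w' by auto
  then have "length (bits x) = length (bits x')" "length (bits y) = length (bits y')"
    by (simp_all add: length_bits)
  then have "bits x = bits x'" "bits y = bits y'" "bits z = bits z'" "s = s'"
    using DN.prems w' by auto
  then show ?case using DN.IH sh w' by blast
qed

lemma bits_surj: "length bs = quads t \<Longrightarrow> \<exists>w. shape w = t \<and> bits w = bs"
proof (induction t arbitrary: bs)
  case SL
  then show ?case by (intro exI[of _ DL]) auto
next
  case (SU t)
  then obtain w where "shape w = t" "bits w = bs" by auto
  then show ?case by (intro exI[of _ "DU w"]) auto
next
  case (SN x y z)
  obtain s cs where bs: "bs = s # cs" using SN.prems by (cases bs) auto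
  let ?a = "take (quads x) cs" and ?b = "take (quads y) (drop (quads x) cs)"
    and ?c = "drop (quads y) (drop (quads x) cs)"
  have "length cs = quads x + quads y + quads z" using SN.prems bs by simp
  then have "length ?a = quads x" "length ?b = quads y" "length ?c = quads z" by auto
  then obtain u v w where "shape u = x" "bits u = ?a" "shape v = y" "bits v = ?b" "shape w = z" "bits w = ?c"
    using SN.IH by metis
  moreover have "cs = ?a @ ?b @ ?c" by (metis append_take_drop_id)
  ultimately show ?case using bs by (intro exI[of _ "DN s u v w"]) simp
qed

lemma toggle_shape: "toggle w w' \<Longrightarrow> shape w' = shape w"
  by (induction rule: toggle.induct) auto

lemma toggle_differ1: "toggle w w' \<Longrightarrow> differ1 (bits w) (bits w')"
proof (induction rule: toggle.induct)
  case (toggle_1 x x' s y z)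
  then show ?case using toggle_shape by (simp add: differ1_append length_bits)
next
  case (toggle_2 y y' s x z)
  then show ?case using toggle_shape by (simp add: differ1_append length_bits)
next
  case (toggle_3 z z' s x y)
  then show ?case by (simp add: differ1_append)
qed auto

lemma differ1_toggle: "\<lbrakk>shape w = shape w'; differ1 (bits w) (bits w')\<rbrakk> \<Longrightarrow> toggle w w'"
proof (induction w arbitrary: w')
  case DL
  then show ?case by (cases w') auto
next
  case (DU w)
  then show ?case by (cases w') (auto intro: toggle.intros)
next
  case (DN s x y z)
  then obtain s' x' y' z' where w': "w' = DN s' x' y' z'" by (cases w') auto
  have sh: "shape x = shape x'" "shape y = shape y'" "shape z = shape z'" using DN.prems w' by auto
  then have len: "length (bits x) = length (bits x')" "length (bits y) = length (bits y')"
    by (simp_all add: length_bits)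
  show ?case
  proof (cases "s = s'")
    case True
    then consider "differ1 (bits x) (bits x')" "bits y = bits y'" "bits z = bits z'"
      | "bits x = bits x'" "differ1 (bits y) (bits y')" "bits z = bits z'"
      | "bits x = bits x'" "bits y = bits y'" "differ1 (bits z) (bits z')"
      using DN.prems(2) w' len by (auto simp: differ1_append)
    then show ?thesis
    proof cases
      case 1
      then have "y = y'" "z = z'" using bits_inj sh by blast+
      then show ?thesis using DN.IH(1)[OF sh(1)] 1 True w' by (simp add: toggle.toggle_1)
    next
      case 2
      then have "x = x'" "z = z'" using bits_inj sh by blast+
      then show ?thesis using DN.IH(2)[OF sh(2)] 2 True w' by (simp add: toggle.toggle_2)
    next
      case 3
      then have "x = x'" "y = y'" using bits_inj sh by blast+
      then show ?thesis using DN.IH(3)[OF sh(3)] 3 True w' by (simp add: toggle.toggle_3)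
    qed
  next
    case False
    then have "s' = (\<not> s)" "bits x = bits x'" "bits y = bits y'" "bits z = bits z'"
      using DN.prems(2) w' len by auto
    then have "x = x'" "y = y'" "z = z'" using bits_inj sh by blast+
    then show ?thesis using \<open>s' = (\<not> s)\<close> w' by (simp add: toggle.toggle_root)
  qed
qed

definition dt_edges :: "dt set set" where
  "dt_edges = {{u, v} | u v. toggle u v \<or> move u v}"

lemma dt_edgesI: "toggle u v \<Longrightarrow> {u, v} \<in> dt_edges" "move u v \<Longrightarrow> {u, v} \<in> dt_edges"
  by (auto simp: dt_edges_def)

text \<open>The admissible prescribed edges: as the root state is kept, they are never rungs and are
  not spent when dissections are merged.\<close>

definition inner_toggle :: "dt \<Rightarrow> dt \<Rightarrow> bool" where
  "inner_toggle u u' \<longleftrightarrow> toggle u u' \<and>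
    (\<exists>s x y z x' y' z'. u = DN s x y z \<and> u' = DN s x' y' z')"

text \<open>This is \<open>cube_cycle\<close> transported back along \<open>bits\<close>; the first
  coordinate is the root quadrangle, so its toggles are the rungs.\<close>

lemma shape_cycle:
  assumes "inner_toggle u u'" "shape u = SN x y z"
  shows "cyclic dt_edges {w. shape w = SN x y z}
    (insert {u, u'} {{DN True a b c, DN False a b c} | a b c. shape a = x \<and> shape b = y \<and> shape c = z})"
proof -
  let ?t = "SN x y z"
  define n where "n = quads x + quads y + quads z"
  obtain s a b c a' b' c' where u: "u = DN s a b c" "u' = DN s a' b' c'" and tg: "toggle u u'"
    using assms(1) by (auto simp: inner_toggle_def)
  let ?b = "bits a @ bits b @ bits c" and ?b' = "bits a' @ bits b' @ bits c'"
  have bu: "bits u = s # ?b" "bits u' = s # ?b'" using u by auto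
  have shu: "shape u = ?t" "shape u' = ?t" using assms(2) toggle_shape[OF tg] by auto
  have len: "length ?b = n" "length ?b' = n"
    using length_bits[of u] length_bits[of u'] shu u by (auto simp: n_def)
  have d: "differ1 ?b ?b'" using toggle_differ1[OF tg] bu by simp
  define f where "f = inv_into {w. shape w = ?t} bits"
  have inj: "inj_on bits {w. shape w = ?t}" by (rule inj_onI) (use bits_inj in auto)
  have img: "bits ` {w. shape w = ?t} = {bs. length bs = Suc n}"
    using bits_surj[of _ ?t] by (auto simp: length_bits n_def image_iff)
  have f_bits: "f (bits w) = w" if "shape w = ?t" for w
    unfolding f_def using inv_into_f_f[OF inj] that by simp
  have bits_f: "bits (f bs) = bs" "shape (f bs) = ?t" if "length bs = Suc n" for bs
    using that img f_inv_into_f[of bs bits "{w. shape w = ?t}"] inv_into_into[of bs bits "{w. shape w = ?t}"]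
    unfolding f_def by auto
  have cyc: "cyclic dt_edges (f ` {bs. length bs = Suc n}) (image f ` (insert {s # ?b, s # ?b'} {{True # c, False # c} | c. length c = n}))"
  proof (rule cyclic_image[OF cube_cycle[OF d len]])
    show "inj_on f {bs. length bs = Suc n}" by (rule inj_on_inverseI[of _ bits]) (use bits_f in auto)
    fix e assume "e \<in> cube_edges" "e \<subseteq> {bs. length bs = Suc n}"
    then obtain p q where "e = {p, q}" "differ1 p q" "length p = Suc n" "length q = Suc n"
      unfolding cube_edges_def by auto
    then show "f ` e \<in> dt_edges"
      using differ1_toggle[of "f p" "f q"] bits_f dt_edgesI(1) by simp
  qed
  have f_img: "f ` {bs. length bs = Suc n} = {w. shape w = ?t}"
    unfolding img[symmetric] image_image using f_bits by simp
  have sub: "insert {u, u'} {{DN True a b c, DN False a b c} | a b c. shape a = x \<and> shape b = y \<and> shape c = z}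
    \<subseteq> image f ` (insert {s # ?b, s # ?b'} {{True # c, False # c} | c. length c = n})"
  proof -
    have e: "{u, u'} = f ` {s # ?b, s # ?b'}"
      using f_bits[OF shu(1)] f_bits[OF shu(2)] bu by simp
    have r: "{DN True a b c, DN False a b c} = f ` {True # (bits a @ bits b @ bits c), False # (bits a @ bits b @ bits c)}"
      "length (bits a @ bits b @ bits c) = n"
      if "shape a = x" "shape b = y" "shape c = z" for a b c
      using f_bits[of "DN True a b c"] f_bits[of "DN False a b c"] that by (simp_all add: length_bits n_def)
    show ?thesis
    proof (intro insert_subsetI subsetI)
      show "{u, u'} \<in> image f ` (insert {s # ?b, s # ?b'} {{True # c, False # c} | c. length c = n})"
        unfolding e by (rule imageI) simp
    next
      fix g assume "g \<in> {{DN True a b c, DN False a b c} | a b c. shape a = x \<and> shape b = y \<and> shape c = z}"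
      then obtain a b c where "g = {DN True a b c, DN False a b c}" and sh: "shape a = x" "shape b = y" "shape c = z"
        by blast
      then show "g \<in> image f ` (insert {s # ?b, s # ?b'} {{True # c, False # c} | c. length c = n})"
        using r[OF sh] by blast
    qed
  qed
  show ?thesis by (rule cyclic_mono[OF cyc[unfolded f_img] sub])
qed

section \<open>Merging the dissections with given child sizes\<close>

definition block :: "bool \<Rightarrow> nat \<Rightarrow> nat \<Rightarrow> nat \<Rightarrow> dt set" where
  "block d a b c = {DN s x y z | s x y z. shape x \<in> shps d a \<and> shape y \<in> shps False b \<and> shape z \<in> shps False c}"

fun move3 :: "dt \<times> dt \<times> dt \<Rightarrow> dt \<times> dt \<times> dt \<Rightarrow> bool" where
  "move3 (x, y, z) (x', y', z') \<longleftrightarrow> move x x' \<and> y = y' \<and> z = z' \<or> x = x' \<and> move y y' \<and> z = z' \<or>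
    x = x' \<and> y = y' \<and> move z z'"

fun step3 :: "shp \<times> shp \<times> shp \<Rightarrow> shp \<times> shp \<times> shp \<Rightarrow> bool" where
  "step3 (x, y, z) (x', y', z') \<longleftrightarrow> step x x' \<and> y = y' \<and> z = z' \<or> x = x' \<and> step y y' \<and> z = z' \<or>
    x = x' \<and> y = y' \<and> step z z'"

lemma inner_toggle_exists:
  assumes "0 < quads x + quads y + quads z"
  shows "\<exists>u u'. inner_toggle u u' \<and> shape u = SN x y z"
proof -
  have ex: "\<exists>w'. toggle (frozen True t) w'" if "0 < quads t" for t
    using that by (induction t) (auto intro: toggle.intros)
  let ?x = "frozen True x" and ?y = "frozen True y" and ?z = "frozen True z"
  consider "0 < quads x" | "0 < quads y" | "0 < quads z" using assms by linarith
  then show ?thesis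
  proof cases
    case 1
    then obtain w where "toggle ?x w" using ex by blast
    then show ?thesis
      by (intro exI[of _ "DN True ?x ?y ?z"] exI[of _ "DN True w ?y ?z"]) (auto simp: inner_toggle_def intro: toggle.intros)
  next
    case 2
    then obtain w where "toggle ?y w" using ex by blast
    then show ?thesis
      by (intro exI[of _ "DN True ?x ?y ?z"] exI[of _ "DN True ?x w ?z"]) (auto simp: inner_toggle_def intro: toggle.intros)
  next
    case 3
    then obtain w where "toggle ?z w" using ex by blast
    then show ?thesis
      by (intro exI[of _ "DN True ?x ?y ?z"] exI[of _ "DN True ?x ?y w"]) (auto simp: inner_toggle_def intro: toggle.intros)
  qed
qed

lemma step3_reach:
  assumes "step\<^sup>*\<^sup>* x x'" "step\<^sup>*\<^sup>* y y'" "step\<^sup>*\<^sup>* z z'"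
  shows "step3\<^sup>*\<^sup>* (x, y, z) (x', y', z')"
proof -
  have "step3\<^sup>*\<^sup>* (x, y, z) (x', y, z)"
    using assms(1) by (induction rule: rtranclp_induct) (auto elim!: rtranclp.rtrancl_into_rtrancl)
  also have "step3\<^sup>*\<^sup>* (x', y, z) (x', y', z)"
    using assms(2) by (induction rule: rtranclp_induct) (auto elim!: rtranclp.rtrancl_into_rtrancl)
  also have "step3\<^sup>*\<^sup>* (x', y', z) (x', y', z')"
    using assms(3) by (induction rule: rtranclp_induct) (auto elim!: rtranclp.rtrancl_into_rtrancl)
  finally show ?thesis .
qed

text \<open>Flips across the sides of the root quadrangle leave the block and are not counted by
  \<open>move3\<close>. The two children that do not take part can therefore be frozen independently
  of the one with the unique move.\<close>

lemma step3_unique_move: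
  assumes "step3 i j" "i \<in> shps d a \<times> shps False b \<times> shps False c"
  shows "\<exists>h h'. map_prod shape (map_prod shape shape) h = i \<and> map_prod shape (map_prod shape shape) h' = j \<and>
    move3 h h' \<and> (\<forall>h''. move3 h h'' \<longrightarrow> h'' = h')"
proof -
  obtain x y z x' y' z' where ij: "i = (x, y, z)" "j = (x', y', z')" by (cases i; cases j)
  have wf: "wf_shp d x" "wf_shp False y" "wf_shp False z" using assms(2) ij by (auto simp: shps_def)
  have fz: "\<not> move (frozen True x) v" "\<not> move (frozen True y) v" "\<not> move (frozen True z) v" for v
    using wf not_move_frozen by blast+
  consider "step x x'" "y = y'" "z = z'" | "x = x'" "step y y'" "z = z'" | "x = x'" "y = y'" "step z z'"
    using assms(1) ij by auto
  then show ?thesis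
  proof cases
    case 1
    then obtain w w' where w: "shape w = x" "shape w' = x'" "move w w'" "\<forall>v. move w v \<longrightarrow> v = w'"
      using step_unique_move wf by blast
    have mv: "move3 (w, frozen True y, frozen True z) (w', frozen True y, frozen True z)" using w(3) by simp
    have un: "\<forall>h. move3 (w, frozen True y, frozen True z) h \<longrightarrow> h = (w', frozen True y, frozen True z)"
    proof (intro allI impI)
      fix h assume "move3 (w, frozen True y, frozen True z) h"
      then show "h = (w', frozen True y, frozen True z)"
        using w(4) fz by (cases h) (simp only: move3.simps prod.inject, blast)
    qed
    show ?thesis
      by (intro exI[of _ "(w, frozen True y, frozen True z)"] exI[of _ "(w', frozen True y, frozen True z)"] conjI mv un)
        (use w(1,2) 1 ij in simp_all)
  next
    case 2
    then obtain w w' where w: "shape w = y" "shape w' = y'" "move w w'" "\<forall>v. move w v \<longrightarrow> v = w'"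
      using step_unique_move wf by blast
    have mv: "move3 (frozen True x, w, frozen True z) (frozen True x, w', frozen True z)" using w(3) by simp
    have un: "\<forall>h. move3 (frozen True x, w, frozen True z) h \<longrightarrow> h = (frozen True x, w', frozen True z)"
    proof (intro allI impI)
      fix h assume "move3 (frozen True x, w, frozen True z) h"
      then show "h = (frozen True x, w', frozen True z)"
        using w(4) fz by (cases h) (simp only: move3.simps prod.inject, blast)
    qed
    show ?thesis
      by (intro exI[of _ "(frozen True x, w, frozen True z)"] exI[of _ "(frozen True x, w', frozen True z)"] conjI mv un)
        (use w(1,2) 2 ij in simp_all)
  next
    case 3
    then obtain w w' where w: "shape w = z" "shape w' = z'" "move w w'" "\<forall>v. move w v \<longrightarrow> v = w'"
      using step_unique_move wf by blast
    have mv: "move3 (frozen True x, frozen True y, w) (frozen True x, frozen True y, w')" using w(3) by simp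
    have un: "\<forall>h. move3 (frozen True x, frozen True y, w) h \<longrightarrow> h = (frozen True x, frozen True y, w')"
    proof (intro allI impI)
      fix h assume "move3 (frozen True x, frozen True y, w) h"
      then show "h = (frozen True x, frozen True y, w')"
        using w(4) fz by (cases h) (simp only: move3.simps prod.inject, blast)
    qed
    show ?thesis
      by (intro exI[of _ "(frozen True x, frozen True y, w)"] exI[of _ "(frozen True x, frozen True y, w')"] conjI mv un)
        (use w(1,2) 3 ij in simp_all)
  qed
qed

text \<open>For each dissection \<open>shape_cycle\<close> provides one edge besides the rungs,
  which is why \<open>P_unique\<close> is demanded. All of these edges survive, since the merging
  takes place along rungs only.\<close>

lemma block_cycle:
  assumes "0 < a + b + c"
    and P: "\<And>u u'. (u, u') \<in> P \<Longrightarrow> inner_toggle u u'"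
    and P_unique: "\<And>u u' v v'. \<lbrakk>(u, u') \<in> P; (v, v') \<in> P; shape u = shape v\<rbrakk> \<Longrightarrow> u = v \<and> u' = v'"
  shows "cyclic dt_edges (block d a b c) {{u, u'} | u u'. (u, u') \<in> P \<and> u \<in> block d a b c}"
proof -
  let ?I = "shps d a \<times> shps False b \<times> shps False c"
  define part where "part = map_prod shape (map_prod shape shape)"
  define vx where "vx s h = (case h of (x, y, z) \<Rightarrow> DN s x y z)" for s h
  define nd where "nd i = (case i of (x, y, z) \<Rightarrow> SN x y z)" for i
  \<comment> \<open>The extra edge for each dissection is the one in \<open>P\<close> if there is
    one, and otherwise an arbitrary inner toggle, which exists because some child is
    nonempty.\<close>
  have ex: "\<exists>p. inner_toggle (fst p) (snd p) \<and> shape (fst p) = nd i \<and> (\<forall>q\<in>P. shape (fst q) = nd i \<longrightarrow> p = q)"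
    if i: "i \<in> ?I" for i
  proof (cases "\<exists>q\<in>P. shape (fst q) = nd i")
    case True
    then obtain q where q: "q \<in> P" "shape (fst q) = nd i" by blast
    have "q = q'" if "q' \<in> P" "shape (fst q') = nd i" for q'
      using P_unique[of "fst q" "snd q" "fst q'" "snd q'"] q that by (simp add: prod_eq_iff)
    moreover have "inner_toggle (fst q) (snd q)" using q P by simp
    ultimately show ?thesis using q by blast
  next
    case False
    obtain u u' where "inner_toggle u u'" "shape u = nd i"
      using inner_toggle_exists[of "fst i" "fst (snd i)" "snd (snd i)"] i assms(1)
      by (auto simp: nd_def shps_def)
    then show ?thesis using False by (intro exI[of _ "(u, u')"]) auto
  qed
  obtain kk where kk: "\<forall>i\<in>?I. inner_toggle (fst (kk i)) (snd (kk i)) \<and> shape (fst (kk i)) = nd i \<and>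
    (\<forall>q\<in>P. shape (fst q) = nd i \<longrightarrow> kk i = q)"
    using bchoice[of ?I "\<lambda>i p. inner_toggle (fst p) (snd p) \<and> shape (fst p) = nd i \<and> (\<forall>q\<in>P. shape (fst q) = nd i \<longrightarrow> p = q)"]
      ex by blast
  define k where "k i = fst (kk i)" for i
  define k' where "k' i = snd (kk i)" for i
  have k: "inner_toggle (k i) (k' i)" "shape (k i) = nd i"
    "\<And>v v'. \<lbrakk>(v, v') \<in> P; shape v = nd i\<rbrakk> \<Longrightarrow> k i = v \<and> k' i = v'" if "i \<in> ?I" for i
    using kk that unfolding k_def k'_def by fastforce+
  define K where "K i = (if i \<in> ?I then {{k i, k' i}} else {})" for i
  have B: "{vx s h | s h. part h = i} = {w. shape w = nd i}" for i
  proof -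
    have "shape w = nd i \<longleftrightarrow> (\<exists>s h. w = vx s h \<and> part h = i)" for w
      by (cases w) (auto simp: vx_def part_def nd_def split: prod.splits)
    then show ?thesis by blast
  qed
  have cyc: "cyclic dt_edges {vx s h | s h. part h = i} ((\<lambda>h. {vx True h, vx False h}) ` {h. part h = i} \<union> K i)"
    if i: "i \<in> ?I" for i
  proof -
    obtain x y z where xyz: "i = (x, y, z)" by (cases i)
    have c: "cyclic dt_edges {w. shape w = SN x y z}
      (insert {k i, k' i} {{DN True a b c, DN False a b c} | a b c. shape a = x \<and> shape b = y \<and> shape c = z})"
      using k(1,2)[OF i] by (intro shape_cycle) (auto simp: nd_def xyz)
    have "{vx True h, vx False h} \<in> {{DN True a b c, DN False a b c} | a b c. shape a = x \<and> shape b = y \<and> shape c = z}"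
      if "part h = i" for h
    proof -
      obtain p q r where "h = (p, q, r)" by (cases h)
      then show ?thesis using that
        by (intro CollectI exI[of _ p] exI[of _ q] exI[of _ r]) (simp add: vx_def part_def xyz)
    qed
    then have "(\<lambda>h. {vx True h, vx False h}) ` {h. part h = i} \<union> K i \<subseteq>
      insert {k i, k' i} {{DN True a b c, DN False a b c} | a b c. shape a = x \<and> shape b = y \<and> shape c = z}"
      using i by (auto simp only: K_def if_True)
    from cyclic_mono[OF c this] show ?thesis unfolding B by (simp add: nd_def xyz)
  qed
  \<comment> \<open>Parts are triples of child shapes, and \<open>h\<close> is a triple of decorated
    children without the root state. Steps are restricted to \<open>?I\<close>, as unique moves are
    known for well-formed shapes only.\<close>
  have glued: "cyclic dt_edges (\<Union>i\<in>?I. {vx s h | s h. part h = i}) (\<Union>i\<in>?I. K i)"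
  proof (rule cyclic_glue_rungs[where r = "(base_shp d a, base_shp False b, base_shp False c)"
        and lk = move3 and step = "\<lambda>i j. i \<in> ?I \<and> step3 i j"])
    show "finite ?I" by (simp add: finite_shps)
    show r: "(base_shp d a, base_shp False b, base_shp False c) \<in> ?I" by (simp add: base_shp_in)
    show "s = s' \<and> h = h'" if "vx s h = vx s' h'" for s h s' h'
      using that by (auto simp: vx_def split: prod.splits)
    show "move3 h' h" if "move3 h h'" for h h'
      using that by (cases h; cases h') (auto intro: move_sym)
    show "{vx s h, vx s h'} \<in> dt_edges" if "move3 h h'" for s h h'
      using that by (cases h; cases h') (auto simp: vx_def intro!: dt_edgesI(2) intro: move.intros)
    show "{vx True h, vx False h} \<notin> K i" for i h
    proof
      assume "{vx True h, vx False h} \<in> K i"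
      then have i: "i \<in> ?I" and eq: "{vx True h, vx False h} = {k i, k' i}"
        by (auto simp: K_def split: if_splits)
      obtain s x y z x' y' z' where "k i = DN s x y z" "k' i = DN s x' y' z'"
        using k(1)[OF i] unfolding inner_toggle_def by blast
      then show False using eq by (cases h) (auto simp: vx_def doubleton_eq_iff)
    qed
    show "\<exists>h h'. part h = i \<and> part h' = j \<and> move3 h h' \<and> (\<forall>h''. move3 h h'' \<longrightarrow> h'' = h')"
      if "i \<in> ?I \<and> step3 i j" for i j
      using step3_unique_move that unfolding part_def by blast
    show closed: "j \<in> ?I" if "i \<in> ?I" "i \<in> ?I \<and> step3 i j" for i j
      using that by (cases i; cases j) (auto simp: shps_def step_wf step_size)
    show "(\<lambda>i j. i \<in> ?I \<and> step3 i j)\<^sup>*\<^sup>* (base_shp d a, base_shp False b, base_shp False c) i" if i: "i \<in> ?I" for i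
    proof -
      have "step3\<^sup>*\<^sup>* (base_shp d a, base_shp False b, base_shp False c) i"
        using i step3_reach reach_base by (cases i) blast
      then show ?thesis
      proof (induction rule: rtranclp_induct)
        case (step y z)
        have "y \<in> ?I" using step.IH
          by (induction rule: rtranclp_induct) (use r closed in blast)+
        then show ?case using step.hyps by (intro rtranclp.rtrancl_into_rtrancl[OF step.IH]) simp
      qed simp
    qed
  qed (use cyc in blast)
  have un: "(\<Union>i\<in>?I. {vx s h | s h. part h = i}) = block d a b c"
    by (auto simp: block_def vx_def part_def split: prod.splits)
  have sub: "{{u, u'} | u u'. (u, u') \<in> P \<and> u \<in> block d a b c} \<subseteq> (\<Union>i\<in>?I. K i)"
  proof clarify
    fix u u' assume u: "(u, u') \<in> P" "u \<in> block d a b c"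
    then obtain s x y z where xyz: "u = DN s x y z" "(shape x, shape y, shape z) \<in> ?I"
      by (auto simp: block_def)
    let ?i = "(shape x, shape y, shape z)"
    have "k ?i = u \<and> k' ?i = u'" using k(3)[OF xyz(2) u(1)] xyz(1) by (simp add: nd_def)
    then have "{u, u'} \<in> K ?i" using xyz(2) by (simp add: K_def)
    then show "{u, u'} \<in> (\<Union>i\<in>?I. K i)" using xyz(2) by blast
  qed
  show ?thesis by (rule cyclic_mono[OF glued[unfolded un] sub])
qed

section \<open>Gluing the blocks\<close>

text \<open>Filler of a given size whose root state alone is free, so that changing \<open>s\<close>
  is a single toggle for positive size and has no effect for size 0.\<close>

fun dcomb :: "bool \<Rightarrow> nat \<Rightarrow> dt" where
  "dcomb s 0 = DL"
| "dcomb s (Suc n) = DN s DL DL (dcomb True n)"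

lemma shape_dcomb [simp]: "shape (dcomb s n) = comb n"
  by (induction n arbitrary: s) auto

lemma toggle_dcomb: "0 < n \<Longrightarrow> toggle (dcomb True n) (dcomb False n)"
  using toggle_root[of True DL DL "dcomb True (n - 1)"] by (cases n) auto

lemma comb_eq_L [simp]: "comb n = SL \<longleftrightarrow> n = 0" "SL = comb n \<longleftrightarrow> n = 0"
  by (cases n; simp)+

definition nil :: "bool \<Rightarrow> dt" where
  "nil d = (if d then DU DL else DL)"

lemma shape_nil [simp]: "shape (nil d) = base_shp d 0"
  by (simp add: nil_def base_shp_def)

lemma base_shp_0_neq_N [simp]: "base_shp d 0 \<noteq> SN x y z" "SN x y z \<noteq> base_shp d 0"
  by (auto simp: base_shp_def)

lemma base_shp_0_wf [simp]: "wf_shp d (base_shp d 0)" "quads (base_shp d 0) = 0"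
  by (auto simp: base_shp_def)

text \<open>Every block except that of the child sizes \<open>(0, 0, n - 1)\<close> has a link to a block closer to
  that one. A link is named by the sizes of subtrees that move; it consists of the two edges
  between \<open>lower\<close> and \<open>upper\<close> for the two values of the Boolean argument, which toggles one
  quadrangle that does not take part in the flip. No shape occurs at the ends of two links.\<close>

datatype link = Mid | Pre nat nat | Pre1 | Fst nat nat nat

text \<open>In \<open>Pre\<close>, \<open>q = 0\<close> would give the central block itself as
  source. In \<open>Fst\<close>, \<open>p = r = 0\<close> would give the upper end the same shape as
  that of \<open>Mid\<close>; the block \<open>(1, n - 2, 0)\<close>, which this link would have
  served, is left to \<open>Pre1\<close>.\<close>

fun valid :: "nat \<Rightarrow> link \<Rightarrow> bool" where
  "valid n Mid \<longleftrightarrow> True"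
| "valid n (Pre q r) \<longleftrightarrow> 0 < q \<and> Suc (Suc (q + r)) = n"
| "valid n Pre1 \<longleftrightarrow> True"
| "valid n (Fst p q r) \<longleftrightarrow> Suc (Suc (p + q + r)) = n \<and> \<not> (p = 0 \<and> r = 0)"

fun source :: "nat \<Rightarrow> link \<Rightarrow> nat \<times> nat \<times> nat" where
  "source n Mid = (0, n - 1, 0)"
| "source n (Pre q r) = (0, q, Suc r)"
| "source n Pre1 = (1, n - 2, 0)"
| "source n (Fst p q r) = (Suc p, q, r)"

fun target :: "nat \<Rightarrow> link \<Rightarrow> nat \<times> nat \<times> nat" where
  "target n Mid = (0, 0, n - 1)"
| "target n (Pre q r) = (n - 1, 0, 0)"
| "target n Pre1 = (n - 1, 0, 0)"
| "target n (Fst p q r) = (0, 0, n - 1)"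

text \<open>The states of the two flipped quadrangles are dictated by the move from
  \<open>lower\<close> to \<open>upper\<close>: \<open>move_23\<close> for \<open>Mid\<close>,
  \<open>move_31\<close> for \<open>Pre\<close>, \<open>move_21\<close> for \<open>Pre1\<close> and
  \<open>move_13\<close> for \<open>Fst\<close>. The disjunctions in \<open>Fst\<close> pass
  \<open>s\<close> to the first nonempty comb only: empty combs ignore it, and all later ones get
  \<open>True\<close>.\<close>

fun lower :: "bool \<Rightarrow> nat \<Rightarrow> bool \<Rightarrow> link \<Rightarrow> dt" where
  "lower d n s Mid = DN False (nil d) (DN False DL DL (dcomb s (n - 2))) DL"
| "lower d n s (Pre q r) = DN True (nil d) (dcomb s q) (DN False (dcomb True r) DL DL)"
| "lower d n s Pre1 = DN True (DN s (nil d) DL DL) (DN True DL (dcomb True (n - 3)) DL) DL"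
| "lower d n s (Fst p q r) = DN False (DN True (nil d) DL (dcomb s p))
     (dcomb (s \<or> p \<noteq> 0) q) (dcomb (s \<or> p \<noteq> 0 \<or> q \<noteq> 0) r)"

fun upper :: "bool \<Rightarrow> nat \<Rightarrow> bool \<Rightarrow> link \<Rightarrow> dt" where
  "upper d n s Mid = DN False (nil d) DL (DN True DL (dcomb s (n - 2)) DL)"
| "upper d n s (Pre q r) = DN False (DN True (nil d) (dcomb s q) (dcomb True r)) DL DL"
| "upper d n s Pre1 = DN True (DN False (DN s (nil d) DL DL) DL (dcomb True (n - 3))) DL DL"
| "upper d n s (Fst p q r) = DN True (nil d) DL (DN False (dcomb s p)
     (dcomb (s \<or> p \<noteq> 0) q) (dcomb (s \<or> p \<noteq> 0 \<or> q \<noteq> 0) r))"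

text \<open>A prescribed edge reserved for odd \<open>N\<close>. There it connects the trees with
  the triangle at the root to all others by \<open>move_UN\<close>, whence the root state
  \<open>False\<close>. It lies in the source block of \<open>Mid\<close>, over a shape that no link
  uses.\<close>

definition spare :: "bool \<Rightarrow> nat \<Rightarrow> bool \<Rightarrow> dt" where
  "spare d n s = DN False (nil d) (DN s (dcomb True (n - 2)) DL DL) DL"

abbreviation blk :: "bool \<Rightarrow> nat \<times> nat \<times> nat \<Rightarrow> dt set" where
  "blk d i \<equiv> block d (fst i) (fst (snd i)) (snd (snd i))"

lemma inner_toggleI:
  "toggle x x' \<Longrightarrow> inner_toggle (DN s x y z) (DN s x' y z)"
  "toggle y y' \<Longrightarrow> inner_toggle (DN s x y z) (DN s x y' z)"
  "toggle z z' \<Longrightarrow> inner_toggle (DN s x y z) (DN s x y z')"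
  by (auto simp: inner_toggle_def intro: toggle.intros)

lemma toggle_root': "toggle (DN True x y z) (DN False x y z)"
  using toggle_root[of True x y z] by simp

lemma inner_toggle_link:
  assumes "3 \<le> n" "valid n i"
  shows "inner_toggle (lower d n True i) (lower d n False i)"
    "inner_toggle (upper d n True i) (upper d n False i)"
proof -
  have "inner_toggle (lower d n True i) (lower d n False i) \<and> inner_toggle (upper d n True i) (upper d n False i)"
  proof (cases i)
    case Mid
    then show ?thesis using assms(1)
      by (auto intro!: inner_toggleI toggle_1 toggle_2 toggle_3 toggle_dcomb)
  next
    case (Pre q r)
    then show ?thesis using assms(2)
      by (auto intro!: inner_toggleI(1) toggle_2 toggle_dcomb) (auto intro!: inner_toggleI(2) toggle_dcomb)
  next
    case Pre1
    then show ?thesis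
      by (auto intro!: inner_toggleI(1) toggle_1 toggle_root')
  next
    case (Fst p q r)
    then consider "0 < p" | "p = 0" "0 < q" | "p = 0" "q = 0" "0 < r"
      using assms by auto
    then show ?thesis
    proof cases
      case 1
      then show ?thesis unfolding Fst
        by (auto intro!: inner_toggleI(1) toggle_3 toggle_dcomb) (auto intro!: inner_toggleI(3) toggle_1 toggle_dcomb)
    next
      case 2
      then show ?thesis unfolding Fst
        by (auto intro!: inner_toggleI(2) toggle_dcomb) (auto intro!: inner_toggleI(3) toggle_2 toggle_dcomb)
    next
      case 3
      then show ?thesis unfolding Fst
        by (auto intro!: inner_toggleI(3) toggle_3 toggle_dcomb)
    qed
  qed
  then show "inner_toggle (lower d n True i) (lower d n False i)"
    "inner_toggle (upper d n True i) (upper d n False i)" by auto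
qed

lemma inner_toggle_spare: "inner_toggle (spare d n True) (spare d n False)"
  unfolding spare_def by (intro inner_toggleI toggle_root')

lemma link_edge: "{upper d n s i, lower d n s i} \<in> dt_edges"
  by (cases i) (auto intro!: dt_edgesI(2) intro: move.intros)

lemma lower_in_block: "\<lbrakk>3 \<le> n; valid n i\<rbrakk> \<Longrightarrow> lower d n s i \<in> blk d (source n i)"
  by (cases i) (auto simp: block_def shps_def)

lemma upper_in_block: "\<lbrakk>3 \<le> n; valid n i\<rbrakk> \<Longrightarrow> upper d n s i \<in> blk d (target n i)"
  by (cases i) (auto simp: block_def shps_def)

lemma spare_in_block: "3 \<le> n \<Longrightarrow> spare d n s \<in> blk d (source n Mid)"
  by (auto simp: spare_def block_def shps_def)

lemma source_inj: "\<lbrakk>3 \<le> n; valid n i; valid n j; source n i = source n j\<rbrakk> \<Longrightarrow> i = j"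
  by (cases i; cases j) auto

lemma block_disjoint: "i \<noteq> j \<Longrightarrow> blk d i \<inter> blk d j = {}"
  by (cases i; cases j) (auto simp: block_def shps_def)

text \<open>Together with \<open>lower_shape_inj\<close> this yields the premise
  \<open>P_unique\<close> of \<open>block_cycle\<close> for the set \<open>marked\<close>.\<close>

lemma link_shapes_distinct:
  assumes "3 \<le> n" "valid n i" "valid n j"
  shows "shape (upper d n s i) = shape (upper d n s' j) \<Longrightarrow> i = j"
    "shape (lower d n s i) \<noteq> shape (upper d n s' j)"
    "shape (spare d n s) \<noteq> shape (lower d n s' i)" "shape (spare d n s) \<noteq> shape (upper d n s' i)"
  using assms by (cases i; cases j; auto simp: spare_def)+

text \<open>A shape determines its block, and distinct links have distinct source blocks.\<close>

lemma lower_shape_inj: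
  assumes "3 \<le> n" "valid n i" "valid n j" "shape (lower d n s i) = shape (lower d n s' j)"
  shows "i = j"
proof -
  have mem: "w \<in> blk d k" if "shape w = shape w'" "w' \<in> blk d k" for w w' k
    using that by (cases w) (auto simp: block_def)
  have "lower d n s i \<in> blk d (source n j)" using mem lower_in_block assms by metis
  moreover have "lower d n s i \<in> blk d (source n i)" using lower_in_block assms by blast
  ultimately have "source n i = source n j" using block_disjoint by blast
  then show ?thesis using source_inj assms by blast
qed

definition marked :: "bool \<Rightarrow> nat \<Rightarrow> (dt \<times> dt) set" where
  "marked d n = insert (spare d n True, spare d n False)
     ((\<lambda>i. (lower d n True i, lower d n False i)) ` {i. valid n i} \<union>
      (\<lambda>i. (upper d n True i, upper d n False i)) ` {i. valid n i})"

lemma marked_block_cycle: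
  assumes "3 \<le> n" "fst i + fst (snd i) + snd (snd i) = n - 1"
  shows "cyclic dt_edges (blk d i) {{u, u'} | u u'. (u, u') \<in> marked d n \<and> u \<in> blk d i}"
proof (rule block_cycle)
  show "0 < fst i + fst (snd i) + snd (snd i)" using assms by simp
  show "inner_toggle u u'" if "(u, u') \<in> marked d n" for u u'
    using that inner_toggle_link inner_toggle_spare assms(1) by (auto simp: marked_def)
  show "u = v \<and> u' = v'" if "(u, u') \<in> marked d n" "(v, v') \<in> marked d n" "shape u = shape v" for u u' v v'
  proof -
    have ll: "i = j" if "valid n i" "valid n j" "shape (lower d n True i) = shape (lower d n True j)" for i j
      using lower_shape_inj[OF assms(1)] that by blast
    have uu: "i = j" if "valid n i" "valid n j" "shape (upper d n True i) = shape (upper d n True j)" for i j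
      using link_shapes_distinct(1)[OF assms(1)] that by blast
    have ne: "shape (lower d n True i) \<noteq> shape (upper d n True j)" "shape (upper d n True j) \<noteq> shape (lower d n True i)"
      "shape (spare d n True) \<noteq> shape (lower d n True i)" "shape (lower d n True i) \<noteq> shape (spare d n True)"
      "shape (spare d n True) \<noteq> shape (upper d n True i)" "shape (upper d n True i) \<noteq> shape (spare d n True)"
      if "valid n i" "valid n j" for i j
      using link_shapes_distinct(2-4)[OF assms(1) that] by metis+
    show ?thesis using that unfolding marked_def
      by (elim insertE UnE imageE) (auto dest: ll uu simp: ne)
  qed
qed

section \<open>Attaching all blocks\<close>

definition nodes :: "bool \<Rightarrow> nat \<Rightarrow> dt set" where
  "nodes d n = {w. wf_shp d (shape w) \<and> quads (shape w) = n}"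

lemma nodes_DN_eq:
  assumes "3 \<le> n"
  shows "nodes d n \<inter> {DN s x y z | s x y z. True} =
    blk d (0, 0, n - 1) \<union> (\<Union>i\<in>{i. valid n i}. blk d (source n i))"
proof -
  have 1: "w \<in> blk d (0, 0, n - 1) \<union> (\<Union>i\<in>{i. valid n i}. blk d (source n i))"
    if w: "w = DN s x y z" "w \<in> nodes d n" for w s x y z
  proof -
    obtain a b c where abc: "a = quads (shape x)" "b = quads (shape y)" "c = quads (shape z)" by blast
    have mem: "w \<in> blk d (a, b, c)" and sum: "a + b + c = n - 1"
      using w abc by (auto simp: nodes_def block_def shps_def)
    have "\<exists>i. valid n i \<and> source n i = (a, b, c)" if ne: "(a, b, c) \<noteq> (0, 0, n - 1)"
    proof -
      consider "a = 0" "c = 0" | "a = 0" "0 < b" "0 < c" | "a = 1" "c = 0" | "0 < a" "\<not> (a = 1 \<and> c = 0)"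
        using sum ne by (cases "a = 0"; cases "b = 0"; cases "c = 0") auto
      then show ?thesis
      proof cases
        case 1
        then show ?thesis using sum by (intro exI[of _ Mid]) auto
      next
        case 2
        then show ?thesis using sum assms by (intro exI[of _ "Pre b (c - 1)"]) auto
      next
        case 3
        then show ?thesis using sum assms by (intro exI[of _ Pre1]) auto
      next
        case 4
        then show ?thesis using sum assms by (intro exI[of _ "Fst (a - 1) b c"]) auto
      qed
    qed
    then show ?thesis using mem by fastforce
  qed
  have 2: "fst (source n i) + fst (snd (source n i)) + snd (snd (source n i)) = n - 1" if "valid n i" for i
    using that assms by (cases i) auto
  have 3: "blk d i \<subseteq> nodes d n \<inter> {DN s x y z | s x y z. True}"
    if "fst i + fst (snd i) + snd (snd i) = n - 1" for i
    using that assms by (auto simp: block_def nodes_def shps_def)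
  show ?thesis
  proof
    show "nodes d n \<inter> {DN s x y z | s x y z. True} \<subseteq>
      blk d (0, 0, n - 1) \<union> (\<Union>i\<in>{i. valid n i}. blk d (source n i))"
      using 1 by blast
    have "blk d (0, 0, n - 1) \<subseteq> nodes d n \<inter> {DN s x y z | s x y z. True}" by (rule 3) simp
    moreover have "blk d (source n i) \<subseteq> nodes d n \<inter> {DN s x y z | s x y z. True}" if "valid n i" for i
      by (rule 3[OF 2[OF that]])
    ultimately show "blk d (0, 0, n - 1) \<union> (\<Union>i\<in>{i. valid n i}. blk d (source n i)) \<subseteq>
      nodes d n \<inter> {DN s x y z | s x y z. True}"
      by blast
  qed
qed

lemma finite_valid: "finite {i. valid n i}"
proof -
  have "{i. valid n i} \<subseteq> {Mid, Pre1} \<union> (\<lambda>(q, r). Pre q r) ` ({..n} \<times> {..n}) \<union>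
    (\<lambda>(p, q, r). Fst p q r) ` ({..n} \<times> {..n} \<times> {..n})"
  proof
    fix i assume "i \<in> {i. valid n i}"
    then show "i \<in> {Mid, Pre1} \<union> (\<lambda>(q, r). Pre q r) ` ({..n} \<times> {..n}) \<union>
      (\<lambda>(p, q, r). Fst p q r) ` ({..n} \<times> {..n} \<times> {..n})"
      by (cases i) (auto simp: image_iff)
  qed
  then show ?thesis by (rule finite_subset) auto
qed

text \<open>Two rounds of attaching: \<open>Pre\<close> and \<open>Pre1\<close> lead only to the
  block \<open>(n - 1, 0, 0)\<close>, which has to be attached to the central block
  \<open>(0, 0, n - 1)\<close> beforehand.\<close>

lemma nodes_DN_cyclic:
  assumes n: "3 \<le> n"
  shows "cyclic dt_edges (nodes d n \<inter> {DN s x y z | s x y z. True}) {{spare d n True, spare d n False}}"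
proof -
  define K where "K i = {{u, u'} | u u'. (u, u') \<in> marked d n \<and> u \<in> blk d i}" for i
  define I1 where "I1 = {i. valid n i \<and> target n i = (0, 0, n - 1)}"
  define I2 where "I2 = {i. valid n i \<and> target n i = (n - 1, 0, 0)}"
  let ?lo = "\<lambda>i. {lower d n True i, lower d n False i}"
  let ?up = "\<lambda>i. {upper d n True i, upper d n False i}"
  have cyc: "cyclic dt_edges (blk d i) (K i)" if "fst i + fst (snd i) + snd (snd i) = n - 1" for i
    unfolding K_def using marked_block_cycle[OF n that] .
  have src: "fst (source n i) + fst (snd (source n i)) + snd (snd (source n i)) = n - 1" if "valid n i" for i
    using that n by (cases i) auto
  have lo: "?lo i \<in> K (source n i)" if "valid n i" for i
    unfolding K_def using that lower_in_block[OF n that] by (auto simp: marked_def)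
  have up: "?up i \<in> K (target n i)" if "valid n i" for i
    unfolding K_def using that upper_in_block[OF n that] by (auto simp: marked_def)
  have up_inj: "i = j" if "valid n i" "valid n j" "?up i = ?up j" for i j
    using that link_shapes_distinct(1)[OF n] unfolding doubleton_eq_iff by metis
  have src_ne: "source n i \<noteq> (0, 0, n - 1)" if "valid n i" for i
    using that n by (cases i) auto
  have I12: "I1 \<union> I2 = {i. valid n i}" "I1 \<inter> I2 = {}"
    unfolding I1_def I2_def using n by (auto, case_tac x, auto)
  have fin: "finite I1" "finite I2" using finite_valid[of n] I12(1) by (metis finite_Un)+
  let ?V1 = "blk d (0, 0, n - 1) \<union> (\<Union>i\<in>I1. blk d (source n i))"
  let ?M1 = "(K (0, 0, n - 1) - ?up ` I1) \<union> (\<Union>i\<in>I1. K (source n i) - {?lo i})"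
  have c1: "cyclic dt_edges ?V1 ?M1"
  proof (rule cyclic_attach[OF fin(1)])
    show "cyclic dt_edges (blk d (0, 0, n - 1)) (K (0, 0, n - 1))" by (rule cyc) simp
    fix i assume "i \<in> I1"
    then have i: "valid n i" "target n i = (0, 0, n - 1)" by (auto simp: I1_def)
    show "cyclic dt_edges (blk d (source n i)) (K (source n i))" by (rule cyc[OF src[OF i(1)]])
    show "blk d (0, 0, n - 1) \<inter> blk d (source n i) = {}" by (rule block_disjoint) (use src_ne i in metis)
    show "?lo i \<in> K (source n i)" by (rule lo[OF i(1)])
    show "?up i \<in> K (0, 0, n - 1)" using up[OF i(1)] i(2) by simp
    show "{upper d n True i, lower d n True i} \<in> dt_edges" "{upper d n False i, lower d n False i} \<in> dt_edges"
      by (rule link_edge)+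
  next
    fix i j assume "i \<in> I1" "j \<in> I1"
    then have ij: "valid n i" "valid n j" by (auto simp: I1_def)
    show "blk d (source n i) \<inter> blk d (source n j) = {}" if "i \<noteq> j"
      by (rule block_disjoint) (use source_inj[OF n ij] that in blast)
    show "i = j" if "?up i = ?up j" by (rule up_inj[OF ij that])
  qed
  \<comment> \<open>The link that brings in the block \<open>(n - 1, 0, 0)\<close> during the first
    round; it is valid because \<open>n - 2\<close> is positive.\<close>
  define l where "l = Fst (n - 2) 0 0"
  have l: "l \<in> I1" "source n l = (n - 1, 0, 0)" using n by (auto simp: l_def I1_def)
  let ?V2 = "?V1 \<union> (\<Union>i\<in>I2. blk d (source n i))"
  let ?M2 = "(?M1 - ?up ` I2) \<union> (\<Union>i\<in>I2. K (source n i) - {?lo i})"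
  have c2: "cyclic dt_edges ?V2 ?M2"
  proof (rule cyclic_attach[OF fin(2) c1])
    fix i assume iI: "i \<in> I2"
    then have i: "valid n i" "target n i = (n - 1, 0, 0)" by (auto simp: I2_def)
    show "cyclic dt_edges (blk d (source n i)) (K (source n i))" by (rule cyc[OF src[OF i(1)]])
    have "blk d (0, 0, n - 1) \<inter> blk d (source n i) = {}" by (rule block_disjoint) (use src_ne i in metis)
    moreover have "blk d (source n j) \<inter> blk d (source n i) = {}" if "j \<in> I1" for j
      by (rule block_disjoint) (use source_inj[OF n, of j i] i that iI I12(2) in \<open>auto simp: I1_def\<close>)
    ultimately show "?V1 \<inter> blk d (source n i) = {}" by blast
    show "?lo i \<in> K (source n i)" by (rule lo[OF i(1)])
    have "?up i \<in> K (source n l)" using up[OF i(1)] i(2) l(2) by simp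
    \<comment> \<open>In this block the first round has spent the lower edge of \<open>l\<close>
      only, and no upper end has the shape of a lower end.\<close>
    moreover have "?up i \<noteq> ?lo l"
      using link_shapes_distinct(2)[OF n, of l i] l(1) i(1) unfolding doubleton_eq_iff I1_def by (metis mem_Collect_eq)
    ultimately show "?up i \<in> ?M1" using l(1) by blast
    show "{upper d n True i, lower d n True i} \<in> dt_edges" "{upper d n False i, lower d n False i} \<in> dt_edges"
      by (rule link_edge)+
  next
    fix i j assume "i \<in> I2" "j \<in> I2"
    then have ij: "valid n i" "valid n j" by (auto simp: I2_def)
    show "blk d (source n i) \<inter> blk d (source n j) = {}" if "i \<noteq> j"
      by (rule block_disjoint) (use source_inj[OF n ij] that in blast)
    show "i = j" if "?up i = ?up j" by (rule up_inj[OF ij that])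
  qed
  let ?s = "{spare d n True, spare d n False}"
  have sK: "?s \<in> K (source n Mid)"
    unfolding K_def using spare_in_block[OF n] by (auto simp: marked_def)
  have sne: "?s \<noteq> ?lo i" "?s \<noteq> ?up i" if "valid n i" for i
    using link_shapes_distinct(3,4)[OF n that that] unfolding doubleton_eq_iff by metis+
  have "?s \<in> K (source n Mid) - {?lo Mid}" using sK sne(1)[of Mid] by simp
  moreover have "Mid \<in> I1" by (simp add: I1_def)
  ultimately have "?s \<in> ?M1" by blast
  moreover have "?s \<notin> ?up ` I2" using sne(2) unfolding I2_def by blast
  ultimately have m2: "?s \<in> ?M2" by blast
  have "cyclic dt_edges ?V2 {?s}"
    by (rule cyclic_mono[OF c2 insert_subsetI[OF m2 empty_subsetI]])
  moreover have "?V2 = nodes d n \<inter> {DN s x y z | s x y z. True}"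
    unfolding nodes_DN_eq[OF n] I12(1)[symmetric] by blast
  ultimately show ?thesis by simp
qed

text \<open>For odd \<open>N\<close> the root side belongs either to a quadrangle or to the triangle
  at the monochromatic side. The trees of the latter kind are a copy of the even case under
  \<open>DU\<close>, and the two cycles are glued along their spare edges.\<close>

lemma nodes_cyclic:
  assumes n: "3 \<le> n"
  shows "cyclic dt_edges (nodes d n) {}"
proof -
  have F: "nodes False n \<inter> {DN s x y z | s x y z. True} = nodes False n"
  proof -
    have "\<exists>s x y z. w = DN s x y z" if "w \<in> nodes False n" for w
      using that n by (cases w) (auto simp: nodes_def)
    then show ?thesis by blast
  qed
  have cF: "cyclic dt_edges (nodes False n) {{spare False n True, spare False n False}}"
    using nodes_DN_cyclic[OF n, of False] unfolding F .
  show ?thesis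
  proof (cases d)
    case False
    then show ?thesis using cyclic_mono[OF cF] by simp
  next
    case True
    have "cyclic dt_edges (DU ` nodes False n) (image DU ` {{spare False n True, spare False n False}})"
    proof (rule cyclic_image[OF cF])
      show "DU ` e \<in> dt_edges" if "e \<in> dt_edges" for e
        using that by (auto simp: dt_edges_def intro: toggle_U move_U)
    qed (simp add: inj_on_def)
    then have cU: "cyclic dt_edges (DU ` nodes False n) {{DU (spare False n True), DU (spare False n False)}}"
      by simp
    let ?D = "{DN s x y z | s x y z. True}"
    have "cyclic dt_edges (DU ` nodes False n \<union> nodes True n \<inter> ?D)
      (({{DU (spare False n True), DU (spare False n False)}} - {{DU (spare False n True), DU (spare False n False)}}) \<union>
       ({{spare True n True, spare True n False}} - {{spare True n True, spare True n False}}))"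
    proof (rule cyclic_glue[OF cU nodes_DN_cyclic[OF n, of True]])
      have "{DU (spare False n s), spare True n s} \<in> dt_edges" for s
        by (auto simp: spare_def nil_def intro!: dt_edgesI(2) move_UN)
      then show "{DU (spare False n True), spare True n True} \<in> dt_edges"
        "{DU (spare False n False), spare True n False} \<in> dt_edges" by blast+
    qed auto
    moreover have "DU ` nodes False n \<union> nodes True n \<inter> ?D = nodes True n"
    proof -
      have "w \<in> DU ` nodes False n \<union> nodes True n \<inter> ?D" if "w \<in> nodes True n" for w
        using that by (cases w) (auto simp: nodes_def)
      moreover have "DU w \<in> nodes True n" if "w \<in> nodes False n" for w
        using that by (simp add: nodes_def)
      ultimately show ?thesis by blast
    qed
    ultimately show ?thesis using True by simp
  qed
qed

section \<open>Colorful triangulations as decorated trees\<close>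

fun bin :: "dt \<Rightarrow> bt" where
  "bin DL = Lf"
| "bin (DU x) = Nd Lf (bin x)"
| "bin (DN False x y z) = Nd (bin x) (Nd (bin y) (bin z))"
| "bin (DN True x y z) = Nd (Nd (bin x) (bin y)) (bin z)"

lemma lv_bin: "wf_shp d (shape w) \<Longrightarrow> lv (bin w) = 2 * quads (shape w) + (if d then 2 else 1)"
proof (induction w arbitrary: d rule: bin.induct)
  case (3 x y z)
  then show ?case using "3.IH"(1)[of d] "3.IH"(2,3)[of False] by auto
next
  case (4 x y z)
  then show ?case using "4.IH"(1)[of d] "4.IH"(2,3)[of False] by auto
qed auto

lemma even_lv_bin: "wf_shp d (shape w) \<Longrightarrow> even (lv (bin w)) = d"
  using lv_bin[of d w] by auto

text \<open>The left subtree has an even number of leaves in exactly one of the two root states, so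
  parity reveals the state. \<open>DU\<close> is told apart from state \<open>False\<close> by
  parity and from state \<open>True\<close> by its left child being a leaf.\<close>

lemma bin_inj: "\<lbrakk>wf_shp d (shape w); wf_shp d (shape w'); bin w = bin w'\<rbrakk> \<Longrightarrow> w = w'"
proof (induction w arbitrary: w' d rule: bin.induct)
  case 1
  then show ?case by (cases w' rule: bin.cases) auto
next
  case (2 x)
  show ?case
  proof (cases w' rule: bin.cases)
    case (2 x')
    then show ?thesis using "2.IH"[of False x'] "2.prems" by simp
  next
    case (3 x' y' z')
    then show ?thesis using even_lv_bin[of d x'] "2.prems" by (auto dest: sym)
  qed (use "2.prems" in auto)
next
  case (3 x y z)
  show ?case
  proof (cases w' rule: bin.cases)
    case (3 x' y' z')
    then show ?thesis using "3.IH"(1)[of d x'] "3.IH"(2)[of False y'] "3.IH"(3)[of False z'] "3.prems" by auto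
  next
    case (4 x' y' z')
    then have "bin x = Nd (bin x') (bin y')" using "3.prems" by simp
    then have "even (lv (bin x)) \<noteq> d"
      using even_lv_bin[of d x'] even_lv_bin[of False y'] "3.prems" 4 by auto
    then show ?thesis using even_lv_bin[of d x] "3.prems" by auto
  next
    case (2 x')
    then show ?thesis using even_lv_bin[of d x] "3.prems" by auto
  qed (use "3.prems" in auto)
next
  case (4 x y z)
  show ?case
  proof (cases w' rule: bin.cases)
    case (4 x' y' z')
    then show ?thesis using "4.IH"(1)[of d x'] "4.IH"(2)[of False y'] "4.IH"(3)[of False z'] "4.prems" by auto
  next
    case (3 x' y' z')
    then have "bin x' = Nd (bin x) (bin y)" using "4.prems" by simp
    then have "even (lv (bin x')) \<noteq> d"
      using even_lv_bin[of d x] even_lv_bin[of False y] "4.prems" 3 by auto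
    then show ?thesis using even_lv_bin[of d x'] "4.prems" 3 by auto
  qed (use "4.prems" in auto)
qed

lemma toggle_rot: "toggle u v \<Longrightarrow> rot (bin u) (bin v) \<or> rot (bin v) (bin u)"
proof (induction rule: toggle.induct)
  case (toggle_root s x y z)
  then show ?case by (cases s) (auto intro: rot.intros)
next
  case (toggle_1 x x' s y z)
  then show ?case by (cases s) (auto intro: rot.intros)
next
  case (toggle_2 y y' s x z)
  then show ?case by (cases s) (auto intro: rot.intros)
next
  case (toggle_3 z z' s x y)
  then show ?case by (cases s) (auto intro: rot.intros)
qed (auto intro: rot.intros)

lemma move_rot: "move u v \<Longrightarrow> rot (bin u) (bin v) \<or> rot (bin v) (bin u)"
proof (induction rule: move.induct)
  case (move_1 x x' s y z)
  then show ?case by (cases s) (auto intro: rot.intros)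
next
  case (move_2 y y' s x z)
  then show ?case by (cases s) (auto intro: rot.intros)
next
  case (move_3 z z' s x y)
  then show ?case by (cases s) (auto intro: rot.intros)
qed (auto intro: rot.intros)

lemma colorful_bin_False:
  "\<lbrakk>wf_shp False (shape w); \<And>k. i \<le> k \<Longrightarrow> col k = odd k\<rbrakk> \<Longrightarrow> colorful_bt col i (bin w)"
proof (induction w arbitrary: i rule: bin.induct)
  case (3 x y z)
  have "odd (lv (bin x))" "odd (lv (bin y))" "odd (lv (bin z))"
    using "3.prems" even_lv_bin[of False] by auto
  then show ?case using "3.IH"[of i] "3.IH"(2,3) "3.prems" by simp
next
  case (4 x y z)
  have "odd (lv (bin x))" "odd (lv (bin y))" "odd (lv (bin z))"
    using "4.prems" even_lv_bin[of False] by auto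
  then show ?case using "4.IH"[of i] "4.IH"(2,3) "4.prems" by simp
qed auto

text \<open>The ends of the root side have different colors, so the apex of the root triangle agrees
  with exactly one of them. The segment between these two points is the monochromatic diagonal; it
  is no side, and the colorful triangle beyond it completes the quadrangle, leaving three parts with
  odd numbers of leaves.\<close>

lemma colorful_imp_bin_False:
  "\<lbrakk>colorful_bt col i t; odd (lv t); \<And>k. i \<le> k \<Longrightarrow> col k = odd k\<rbrakk> \<Longrightarrow>
    \<exists>w. wf_shp False (shape w) \<and> bin w = t"
proof (induction "lv t" arbitrary: t i rule: less_induct)
  case less
  show ?case
  proof (cases t)
    case Lf
    then show ?thesis by (intro exI[of _ DL]) simp
  next
    case t: (Nd l r)
    show ?thesis
    proof (cases "even (lv l)")
      case True
      then obtain a b where l: "l = Nd a b" by (cases l) auto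
      have "odd (lv a)" "odd (lv b)" "odd (lv r)"
        using less.prems True t l by auto
      then obtain u v w where "wf_shp False (shape u)" "bin u = a" "wf_shp False (shape v)" "bin v = b"
        "wf_shp False (shape w)" "bin w = r"
        using less.hyps[of a i] less.hyps[of b "i + lv a"] less.hyps[of r "i + lv l"] less.prems t l by auto
      then show ?thesis using t l by (intro exI[of _ "DN True u v w"]) simp
    next
      case False
      then have "even (lv r)" using less.prems t by simp
      then obtain a b where r: "r = Nd a b" by (cases r) auto
      have "odd (lv a)" "odd (lv b)"
        using less.prems False t r by auto
      then obtain u v w where "wf_shp False (shape u)" "bin u = l" "wf_shp False (shape v)" "bin v = a"
        "wf_shp False (shape w)" "bin w = b"
        using less.hyps[of l i] less.hyps[of a "i + lv l"] less.hyps[of b "i + lv l + lv a"] False less.prems t r by auto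
      then show ?thesis using t r by (intro exI[of _ "DN False u v w"]) simp
    qed
  qed
qed

lemma colorful_bin_True:
  "\<lbrakk>wf_shp True (shape w); col 0; \<And>k. 0 < k \<Longrightarrow> col k = odd k\<rbrakk> \<Longrightarrow> colorful_bt col 0 (bin w)"
proof (induction w rule: bin.induct)
  case (2 x)
  then show ?case using colorful_bin_False[of x 1 col] even_lv_bin[of False x] by auto
next
  case (3 x y z)
  have "even (lv (bin x))" "odd (lv (bin y))" "odd (lv (bin z))"
    using "3.prems" even_lv_bin[of False] even_lv_bin[of True x] by auto
  then show ?case
    using "3.IH"(1) "3.prems" colorful_bin_False[of y "lv (bin x)" col]
      colorful_bin_False[of z "lv (bin x) + lv (bin y)" col] lv_pos[of "bin x"] by simp
next
  case (4 x y z)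
  have "even (lv (bin x))" "odd (lv (bin y))" "odd (lv (bin z))"
    using "4.prems" even_lv_bin[of False] even_lv_bin[of True x] by auto
  then show ?case
    using "4.IH"(1) "4.prems" colorful_bin_False[of y "lv (bin x)" col]
      colorful_bin_False[of z "lv (bin x) + lv (bin y)" col] lv_pos[of "bin x"] by simp
qed auto

text \<open>Positions 0 and 1 now have the same color. The argument changes only when the left child
  is a leaf: then the monochromatic segment of the root triangle is a side of the polygon, no
  triangle lies beyond it, and the root becomes \<open>DU\<close>.\<close>

lemma colorful_imp_bin_True:
  "\<lbrakk>colorful_bt col 0 t; even (lv t); col 0; \<And>k. 0 < k \<Longrightarrow> col k = odd k\<rbrakk> \<Longrightarrow>
    \<exists>w. wf_shp True (shape w) \<and> bin w = t"
proof (induction "lv t" arbitrary: t rule: less_induct)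
  case less
  obtain l r where t: "t = Nd l r" using less.prems(2) by (cases t) auto
  have E: "\<exists>w. wf_shp False (shape w) \<and> bin w = s" if "colorful_bt col j s" "odd (lv s)" "0 < j" for s j
    using colorful_imp_bin_False[OF that(1,2)] less.prems(4) that(3) by auto
  show ?case
  proof (cases "even (lv l)")
    case True
    then have "even (lv r)" using less.prems t by simp
    then obtain a b where r: "r = Nd a b" by (cases r) auto
    have "odd (lv a)" "odd (lv b)" using less.prems True t r by auto
    then obtain u v w where "wf_shp True (shape u)" "bin u = l" "wf_shp False (shape v)" "bin v = a"
      "wf_shp False (shape w)" "bin w = b"
      using less.hyps[of l] E[of "lv l" a] E[of "lv l + lv a" b] True less.prems t r by auto
    then show ?thesis using t r by (intro exI[of _ "DN False u v w"]) simp
  next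
    case False
    then have r: "odd (lv r)" using less.prems t by simp
    show ?thesis
    proof (cases l)
      case Lf
      then obtain w where "wf_shp False (shape w)" "bin w = r"
        using E[of 1 r] r less.prems t by auto
      then show ?thesis using t Lf by (intro exI[of _ "DU w"]) simp
    next
      case l: (Nd a b)
      have "even (lv a)" "odd (lv b)" using less.prems False t l by auto
      then obtain u v w where "wf_shp True (shape u)" "bin u = a" "wf_shp False (shape v)" "bin v = b"
        "wf_shp False (shape w)" "bin w = r"
        using less.hyps[of a] E[of "lv a" b] E[of "lv l" r] r less.prems t l by auto
      then show ?thesis using t l by (intro exI[of _ "DN True u v w"]) simp
    qed
  qed
qed

lemma bin_nodes:
  assumes "3 \<le> N"
  shows "bin ` nodes (odd N) ((N - 2) div 2) = {t. lv t = N - 1 \<and> colorful_bt (pos_color N) 0 t}"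
proof -
  have pos: "pos_color N k = odd k" if "0 < k \<or> even N" for k
    using that by (auto simp: pos_color_def label_def)
  have pos0: "pos_color N 0 = odd N" by (simp add: pos_color_def label_def)
  have iff: "colorful_bt (pos_color N) 0 t \<longleftrightarrow> (\<exists>w. wf_shp (odd N) (shape w) \<and> bin w = t)" if "lv t = N - 1" for t
  proof (cases "odd N")
    case True
    then show ?thesis
      using colorful_imp_bin_True[of "pos_color N" t] colorful_bin_True[of _ "pos_color N"] pos pos0 that assms
      by (auto simp del: One_nat_def)
  next
    case False
    then show ?thesis
      using colorful_imp_bin_False[of "pos_color N" 0 t] colorful_bin_False[of _ 0 "pos_color N"] pos that assms
      by (auto simp del: One_nat_def)
  qed
  have lv: "lv (bin w) = N - 1 \<longleftrightarrow> quads (shape w) = (N - 2) div 2" if "wf_shp (odd N) (shape w)" for w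
    using lv_bin[OF that] assms by (cases "odd N") (auto elim!: oddE evenE)
  show ?thesis
  proof
    show "bin ` nodes (odd N) ((N - 2) div 2) \<subseteq> {t. lv t = N - 1 \<and> colorful_bt (pos_color N) 0 t}"
      using lv iff unfolding nodes_def by blast
    show "{t. lv t = N - 1 \<and> colorful_bt (pos_color N) 0 t} \<subseteq> bin ` nodes (odd N) ((N - 2) div 2)"
    proof
      fix t assume t: "t \<in> {t. lv t = N - 1 \<and> colorful_bt (pos_color N) 0 t}"
      then obtain w where "wf_shp (odd N) (shape w)" "bin w = t" using iff by blast
      then show "t \<in> bin ` nodes (odd N) ((N - 2) div 2)" using lv[of w] t unfolding nodes_def by blast
    qed
  qed
qed

section \<open>The Hamilton cycle in the graph of colorful triangulations\<close>

lemma path_edges_nth: "Suc i < length xs \<Longrightarrow> {xs ! i, xs ! Suc i} \<in> path_edges xs"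
proof (induction xs arbitrary: i rule: path_edges.induct)
  case (1 x y xs)
  then show ?case by (cases i) auto
qed auto

lemma cyclic_imp_hamilton:
  assumes "cyclic (snd G) (fst G) M"
  shows "has_hamilton_cycle G"
proof -
  obtain xs where xs: "distinct xs" "set xs = fst G" "3 \<le> length xs" "cycle_edges xs \<subseteq> snd G"
    using assms unfolding cyclic_def by blast
  have "{xs ! i, xs ! (Suc i mod length xs)} \<in> snd G" if i: "i < length xs" for i
  proof (cases "Suc i < length xs")
    case True
    then show ?thesis using path_edges_nth[of i xs] xs(4) by (auto simp: cycle_edges_def)
  next
    case False
    then have "Suc i = length xs" using i by simp
    moreover from this have "i = length xs - 1" by simp
    moreover have "xs \<noteq> []" using i by auto
    ultimately have "{xs ! i, xs ! (Suc i mod length xs)} = {last xs, hd xs}"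
      by (simp add: last_conv_nth hd_conv_nth)
    then show ?thesis using xs(4) by (simp add: cycle_edges_def)
  qed
  then show ?thesis unfolding has_hamilton_cycle_def hamilton_cycle_def using xs by blast
qed

theorem theorem1:
  fixes N :: nat
  assumes "N \<ge> 8"
  shows "has_hamilton_cycle (colorful_associahedron N)"
proof -
  define n where "n = (N - 2) div 2"
  define f where "f = (\<lambda>w. tri N (bin w))"
  let ?V = "nodes (odd N) n" and ?G = "colorful_associahedron N"
  have N: "3 \<le> N" using assms by simp
  have bin_V: "bin ` ?V = {t. lv t = N - 1 \<and> colorful_bt (pos_color N) 0 t}"
    unfolding n_def by (rule bin_nodes[OF N])
  have V: "lv (bin w) = N - 1" "colorful N (f w)" "triangulation N (f w)" if "w \<in> ?V" for w
  proof -
    have t: "lv (bin w) = N - 1" "colorful_bt (pos_color N) 0 (bin w)" using bin_V that by blast+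
    then show "lv (bin w) = N - 1" "colorful N (f w)" "triangulation N (f w)"
      using colorful_tri_iff[OF N t(1)] triangulation_iff_tri[OF N] unfolding f_def by blast+
  qed
  have f_V: "f ` ?V = fst ?G"
  proof
    show "f ` ?V \<subseteq> fst ?G"
      using V by (auto simp: colorful_associahedron_def induced_sgraph_def associahedron_def)
    show "fst ?G \<subseteq> f ` ?V"
    proof
      fix T assume "T \<in> fst ?G"
      then have T: "triangulation N T" "colorful N T"
        by (auto simp: colorful_associahedron_def induced_sgraph_def associahedron_def)
      then obtain t where t: "lv t = N - 1" "T = tri N t" using triangulation_iff_tri[OF N] by blast
      then have "t \<in> bin ` ?V" unfolding bin_V using T colorful_tri_iff[OF N t(1)] by simp
      then show "T \<in> f ` ?V" using t unfolding f_def by blast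
    qed
  qed
  have "cyclic (snd ?G) (f ` ?V) (image f ` {})"
  proof (rule cyclic_image[OF nodes_cyclic])
    show "3 \<le> n" using assms by (simp add: n_def)
    show "inj_on f ?V"
    proof (rule inj_onI)
      fix w w' assume w: "w \<in> ?V" "w' \<in> ?V" "f w = f w'"
      then have "bin w = bin w'" using tri_inj[OF N] V(1) unfolding f_def by blast
      then show "w = w'" using bin_inj[of "odd N" w w'] w by (simp add: nodes_def)
    qed
    fix e assume e: "e \<in> dt_edges" "e \<subseteq> ?V"
    then obtain u v where uv: "e = {u, v}" "toggle u v \<or> move u v" unfolding dt_edges_def by blast
    then have V_uv: "u \<in> ?V" "v \<in> ?V" using e by auto
    have "rot (bin u) (bin v) \<or> rot (bin v) (bin u)" using uv toggle_rot move_rot by blast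
    then have "flip N (f u) (f v) \<or> flip N (f v) (f u)"
      unfolding f_def using flip_tri[OF N] V(1) V_uv by blast
    then have "{f u, f v} \<in> snd (associahedron N)"
      using V(3) V_uv unfolding associahedron_def by (auto simp: insert_commute)
    then show "f ` e \<in> snd ?G"
      using V(2) V_uv uv unfolding colorful_associahedron_def induced_sgraph_def by simp
  qed
  then have "cyclic (snd ?G) (fst ?G) {}" unfolding f_V by simp
  then show ?thesis by (rule cyclic_imp_hamilton)
qed

end
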